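(* Let $(G,\mu,\alpha)$ and $(G',\mu',\alpha')$ be two Hom-algebras over $\mathbb{K}$, and let $(G^{\circ},\Delta,\alpha^{\circ})$ and $(G'^{\circ},\Delta',\alpha'^{\circ})$ be the corresponding Hom-coalgebras under the Sweedler duality. Let $f:G\to G'$ be a morphism of Hom-algebras, and let $f^{\circ}=f^{*}|_{G'^{\circ}}:G'^{\circ}\to G^{*}$. Then $f^{\circ}$ is a morphism of Hom-coalgebras (from $G'^{\circ}$ to $G^{\circ}$).
   Context: $\mathbb{K}$ is a field of characteristic zero; all linear spaces and tensor products are over $\mathbb{K}$, and $V^*$ is the full linear dual of $V$. A Hom-algebra (Hom-associative algebra) is a triple $(G,\mu,\alpha)$ where $G$ is a linear space, $\mu:G\otimes G\to G$, $\mu(g\otimes g')=gg'$, is a linear map and $\alpha:G\to G$ is a linear map such that $\alpha(g)(hk)=(gh)\alpha(k)$ and $\alpha(hk)=\alpha(h)\alpha(k)$ for all $g,h,k\in G$. No unit is required. A morphism of Hom-algebras $f:(G,\mu,\alpha)\to(G',\mu',\alpha')$ is a linear map with $\mu'\circ(f\otimes f)=f\circ\mu$ and $f\circ\alpha=\alpha'\circ f$. An ideal of $G$ is a subspace $H\subseteq G$ such that $\alpha(H)\subseteq H$ and $ab\in H$, $ba\in H$ for all $a\in G$, $b\in H$. It is finite-codimensional if $\dim(G/H)<\infty$. The Sweedler duality of $G$ is $G^{\circ}=\{\varphi\in G^*\mid \operatorname{Ker} \varphi\supseteq J \text{ for some finite-codimensional ideal } J \text{ of } G\}$. A Hom-coalgebra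 is a triple $(C,\Delta,\beta)$ where $C$ is a linear space and $\Delta:C\to C\otimes C$, $\beta:C\to C$ are linear maps with $(\beta\otimes\Delta)\circ\Delta=(\Delta\otimes\beta)\circ\Delta$ and $\Delta\circ\beta=(\beta\otimes\beta)\circ\Delta$. No counit is required. A morphism of Hom-coalgebras is a linear map commuting with the twisting maps and the comultiplications. The Hom-coalgebra structure on $G^{\circ}$ is $\Delta=\mu^*|_{G^{\circ}}$, $\alpha^{\circ}=\alpha^*|_{G^{\circ}}$, where $\langle\mu^*(\varphi),x\otimes y\rangle=\langle \varphi,\mu(x\otimes y)\rangle$, $\alpha^*(\varphi)=\varphi\circ\alpha$, and $G^{\circ}\otimes G^{\circ}$ is regarded as a subspace of $(G\otimes G)^*$ via $(\varphi\otimes \chi)(x\otimes y)=\varphi(x)\chi(y)$; similarly for $G'^{\circ}$. The map $f^*:G'^*\to G^*$ is $f^*(\varphi)=\varphi\circ f$. The assertion includes that $f^{\circ}(G'^{\circ})\subseteq G^{\circ}$. *)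

theory Defs
  imports Complex_Main "HOL-Library.Function_Algebras"
begin

section \<open>Linear spaces\<close>

text \<open>A linear space is a subspace (the carrier) of a vector space whose vectors are all elements
  of a type. Carriers are needed because the Sweedler dual depends on the algebra; conditions on
  maps are only imposed on carriers.\<close>

record ('k, 'v) lin_space =
  carrier :: "'v set"
  scaling :: "'k \<Rightarrow> 'v \<Rightarrow> 'v"

definition linear_space :: "('k::field, 'v::ab_group_add, 'm) lin_space_scheme \<Rightarrow> bool" where
  "linear_space V \<longleftrightarrow> vector_space (scaling V) \<and> module.subspace (scaling V) (carrier V)"

definition linear_map ::
  "('k::field, 'v::ab_group_add, 'm) lin_space_scheme \<Rightarrow>
   ('k, 'w::ab_group_add, 'n) lin_space_scheme \<Rightarrow> ('v \<Rightarrow> 'w) \<Rightarrow> bool" where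
  "linear_map V W f \<longleftrightarrow>
     (\<forall>v\<in>carrier V. f v \<in> carrier W) \<and>
     (\<forall>v\<in>carrier V. \<forall>v'\<in>carrier V. f (v + v') = f v + f v') \<and>
     (\<forall>a. \<forall>v\<in>carrier V. f (scaling V a v) = scaling W a (f v))"

definition bilinear_map ::
  "('k::field, 'v::ab_group_add, 'm) lin_space_scheme \<Rightarrow>
   ('k, 'w::ab_group_add, 'n) lin_space_scheme \<Rightarrow>
   ('k, 'x::ab_group_add, 'l) lin_space_scheme \<Rightarrow> ('v \<Rightarrow> 'w \<Rightarrow> 'x) \<Rightarrow> bool" where
  "bilinear_map V W X h \<longleftrightarrow>
     (\<forall>v\<in>carrier V. linear_map W X (h v)) \<and>
     (\<forall>w\<in>carrier W. linear_map V X (\<lambda>v. h v w))"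

definition scalars :: "('k::field, 'k) lin_space" where
  "scalars = \<lparr>carrier = UNIV, scaling = (*)\<rparr>"

definition fun_scaling :: "'k::field \<Rightarrow> ('i \<Rightarrow> 'k) \<Rightarrow> 'i \<Rightarrow> 'k" where
  "fun_scaling a f = (\<lambda>i. a * f i)"

text \<open>Functions on a carrier are represented by their extension by zero.\<close>

definition dual_space :: "('k::field, 'v::ab_group_add, 'm) lin_space_scheme \<Rightarrow> ('v \<Rightarrow> 'k) set" where
  "dual_space V = {\<phi>. linear_map V scalars \<phi> \<and> (\<forall>x. x \<notin> carrier V \<longrightarrow> \<phi> x = 0)}"

definition dual_map ::
  "('k::field, 'v::ab_group_add, 'm) lin_space_scheme \<Rightarrow> ('v \<Rightarrow> 'w) \<Rightarrow> ('w \<Rightarrow> 'k) \<Rightarrow> 'v \<Rightarrow> 'k" where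
  "dual_map V f \<phi> = (\<lambda>x. if x \<in> carrier V then \<phi> (f x) else 0)"


section \<open>Tensor products\<close>

text \<open>The tensor product of \<open>V\<close> and \<open>W\<close> is realised inside the dual of the space of bilinear
  forms on \<open>V \<times> W\<close>: the tensor of \<open>v\<close> and \<open>w\<close> is evaluation at \<open>(v, w)\<close>, and the product is the
  span of these evaluations. The universal property of this model is proved below
  (\<open>tensor_prod_universal\<close>, \<open>tensor_prod_unique\<close>).\<close>

type_synonym ('k, 'v, 'w) tensor = "('v \<Rightarrow> 'w \<Rightarrow> 'k) \<Rightarrow> 'k"

definition tensor ::
  "('k::field, 'v::ab_group_add, 'm) lin_space_scheme \<Rightarrow>
   ('k, 'w::ab_group_add, 'n) lin_space_scheme \<Rightarrow> 'v \<Rightarrow> 'w \<Rightarrow> ('k, 'v, 'w) tensor" where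
  "tensor V W v w = (\<lambda>B. if bilinear_map V W scalars B then B v w else 0)"

definition tensor_prod ::
  "('k::field, 'v::ab_group_add, 'm) lin_space_scheme \<Rightarrow>
   ('k, 'w::ab_group_add, 'n) lin_space_scheme \<Rightarrow> ('k, ('k, 'v, 'w) tensor) lin_space" where
  "tensor_prod V W =
     \<lparr>carrier = module.span fun_scaling {tensor V W v w | v w. v \<in> carrier V \<and> w \<in> carrier W},
      scaling = fun_scaling\<rparr>"

text \<open>For linear \<open>f\<close> (from \<open>V\<close> to \<open>V'\<close>) and \<open>g\<close> (from \<open>W\<close> to \<open>W'\<close>), this is the linear map
  \<open>f \<otimes> g\<close>; the arguments \<open>V'\<close> and \<open>W'\<close> are the codomains. See \<open>tensor_map_tensor\<close>.\<close>

definition tensor_map ::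
  "('k::field, 'v'::ab_group_add, 'm) lin_space_scheme \<Rightarrow>
   ('k, 'w'::ab_group_add, 'n) lin_space_scheme \<Rightarrow>
   ('v \<Rightarrow> 'v') \<Rightarrow> ('w \<Rightarrow> 'w') \<Rightarrow> ('k, 'v, 'w) tensor \<Rightarrow> ('k, 'v', 'w') tensor" where
  "tensor_map V' W' f g t =
     (\<lambda>B. if bilinear_map V' W' scalars B then t (\<lambda>v w. B (f v) (g w)) else 0)"

text \<open>The associativity isomorphism from \<open>(U \<otimes> V) \<otimes> W\<close> to \<open>U \<otimes> (V \<otimes> W)\<close>;
  see \<open>tensor_assoc_tensor\<close>.\<close>

definition tensor_assoc ::
  "('k::field, 'u::ab_group_add, 'l) lin_space_scheme \<Rightarrow>
   ('k, 'v::ab_group_add, 'm) lin_space_scheme \<Rightarrow>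
   ('k, 'w::ab_group_add, 'n) lin_space_scheme \<Rightarrow>
   ('k, ('k, 'u, 'v) tensor, 'w) tensor \<Rightarrow> ('k, 'u, ('k, 'v, 'w) tensor) tensor" where
  "tensor_assoc U V W t =
     (\<lambda>B. if bilinear_map U (tensor_prod V W) scalars B
          then t (\<lambda>s w. s (\<lambda>u v. B u (tensor V W v w))) else 0)"

lemma vector_space_fun_scaling: "vector_space (fun_scaling :: 'k::field \<Rightarrow> ('i \<Rightarrow> 'k) \<Rightarrow> 'i \<Rightarrow> 'k)"
  by unfold_locales (auto simp: fun_scaling_def fun_eq_iff algebra_simps)

interpretation fun_vs: vector_space "fun_scaling :: 'k::field \<Rightarrow> ('i \<Rightarrow> 'k) \<Rightarrow> 'i \<Rightarrow> 'k"
  by (rule vector_space_fun_scaling)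

lemma linear_space_tensor_prod: "linear_space (tensor_prod V W)"
  by (simp add: linear_space_def tensor_prod_def vector_space_fun_scaling)

lemma scaling_tensor_prod [simp]: "scaling (tensor_prod V W) = fun_scaling"
  by (simp add: tensor_prod_def)

lemma tensor_in_tensor_prod:
  "v \<in> carrier V \<Longrightarrow> w \<in> carrier W \<Longrightarrow> tensor V W v w \<in> carrier (tensor_prod V W)"
  by (auto simp: tensor_prod_def intro!: fun_vs.span_base)

lemma bilinear_tensor: "bilinear_map V W (tensor_prod V W) (tensor V W)"
  unfolding bilinear_map_def linear_map_def
  by (auto simp: tensor_in_tensor_prod)
    (auto simp: tensor_def tensor_prod_def fun_scaling_def scalars_def fun_eq_iff
       bilinear_map_def linear_map_def)

lemma tensor_prod_induct [consumes 1, case_names tensor zero add scaling]: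
  assumes "t \<in> carrier (tensor_prod V W)"
    and "\<And>v w. v \<in> carrier V \<Longrightarrow> w \<in> carrier W \<Longrightarrow> P (tensor V W v w)"
    and "P 0" and "\<And>s t. P s \<Longrightarrow> P t \<Longrightarrow> P (s + t)" and "\<And>a t. P t \<Longrightarrow> P (fun_scaling a t)"
  shows "P t"
proof -
  have "P t" if "t \<in> fun_vs.span {tensor V W v w | v w. v \<in> carrier V \<and> w \<in> carrier W}"
    using that
  proof (induction rule: fun_vs.span_induct_alt)
    case base
    show ?case by (rule assms(3))
  next
    case (step c x y)
    then obtain v w where "x = tensor V W v w" "v \<in> carrier V" "w \<in> carrier W" by blast
    then show ?case using step by (metis assms(2,4,5))
  qed
  then show ?thesis using assms(1) by (simp add: tensor_prod_def)
qed

lemma tensor_map_tensor: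
  assumes "linear_map V V' f" "linear_map W W' g" "v \<in> carrier V" "w \<in> carrier W"
  shows "tensor_map V' W' f g (tensor V W v w) = tensor V' W' (f v) (g w)"
proof -
  have "bilinear_map V W scalars (\<lambda>v w. B (f v) (g w))" if "bilinear_map V' W' scalars B" for B
    using that assms(1,2) by (auto simp: bilinear_map_def linear_map_def)
  then show ?thesis by (auto simp: tensor_map_def tensor_def fun_eq_iff)
qed

lemma tensor_assoc_tensor:
  assumes W: "linear_space W"
    and u: "u \<in> carrier U" and v: "v \<in> carrier V" and w: "w \<in> carrier W"
  shows "tensor_assoc U V W (tensor (tensor_prod U V) W (tensor U V u v) w)
       = tensor U (tensor_prod V W) u (tensor V W v w)"
proof -
  have add: "w + w' \<in> carrier W" if "w \<in> carrier W" "w' \<in> carrier W" for w w'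
    using W that by (auto simp: linear_space_def module_iff_vector_space[symmetric] intro: module.subspace_add)
  have scale: "scaling W a w \<in> carrier W" if "w \<in> carrier W" for a w
    using W that by (auto simp: linear_space_def module_iff_vector_space[symmetric] intro: module.subspace_scale)
  have inner: "bilinear_map U V scalars (\<lambda>u v. B u (tensor V W v w))"
    if B: "bilinear_map U (tensor_prod V W) scalars B" and "w \<in> carrier W" for B w
    using B bilinear_tensor[of V W] \<open>w \<in> carrier W\<close>
    by (auto simp: bilinear_map_def linear_map_def scalars_def)
  have outer: "bilinear_map (tensor_prod U V) W scalars (\<lambda>s w. s (\<lambda>u v. B u (tensor V W v w)))"
    if B: "bilinear_map U (tensor_prod V W) scalars B" for B
    unfolding bilinear_map_def
  proof (intro conjI ballI)
    fix w assume "w \<in> carrier W"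
    show "linear_map (tensor_prod U V) scalars (\<lambda>s. s (\<lambda>u v. B u (tensor V W v w)))"
      by (auto simp: linear_map_def scalars_def tensor_prod_def fun_scaling_def)
  next
    fix s assume "s \<in> carrier (tensor_prod U V)"
    then show "linear_map W scalars (\<lambda>w. s (\<lambda>u v. B u (tensor V W v w)))"
    proof (induction rule: tensor_prod_induct)
      case (tensor u v)
      note inner' = inner[OF B]
      show ?case
        unfolding linear_map_def
      proof (intro conjI ballI allI)
        fix w assume "w \<in> carrier W"
        show "tensor U V u v (\<lambda>u v. B u (tensor V W v w)) \<in> carrier scalars"
          by (simp add: scalars_def)
      next
        fix w w' assume "w \<in> carrier W" "w' \<in> carrier W"
        moreover from this have "w + w' \<in> carrier W" by (rule add)
        ultimately show "tensor U V u v (\<lambda>u v. B u (tensor V W v (w + w'))) =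
            tensor U V u v (\<lambda>u v. B u (tensor V W v w)) + tensor U V u v (\<lambda>u v. B u (tensor V W v w'))"
          using B bilinear_tensor[of V W] tensor inner'
          by (auto simp: tensor_def[of U] bilinear_map_def[of U "tensor_prod V W"]
              bilinear_map_def[of V W "tensor_prod V W"] linear_map_def)
      next
        fix a w assume "w \<in> carrier W"
        moreover from this have "scaling W a w \<in> carrier W" by (rule scale)
        ultimately show "tensor U V u v (\<lambda>u v. B u (tensor V W v (scaling W a w))) =
            scaling scalars a (tensor U V u v (\<lambda>u v. B u (tensor V W v w)))"
          using B bilinear_tensor[of V W] tensor inner'
          by (auto simp: tensor_def[of U] bilinear_map_def[of U "tensor_prod V W"]
              bilinear_map_def[of V W "tensor_prod V W"] linear_map_def scaling_tensor_prod)
      qed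
    next
      case zero
      show ?case by (auto simp: linear_map_def scalars_def)
    next
      case (add s t)
      then show ?case by (auto simp: linear_map_def scalars_def algebra_simps)
    next
      case (scaling a t)
      then show ?case by (auto simp: linear_map_def scalars_def fun_scaling_def algebra_simps)
    qed
  qed
  show ?thesis
    using inner outer w by (auto simp: tensor_assoc_def tensor_def fun_eq_iff)
qed


lemma separating_functional:
  assumes X: "linear_space X" and "x \<noteq> 0"
  obtains l where "linear_map X scalars l" "l x \<noteq> 0"
proof -
  interpret X: vector_space "scaling X" using X by (simp add: linear_space_def)
  interpret K: vector_space "(*) :: 'a \<Rightarrow> 'a \<Rightarrow> 'a" by unfold_locales (auto simp: algebra_simps)
  interpret P: vector_space_pair "scaling X" "(*) :: 'a \<Rightarrow> 'a \<Rightarrow> 'a" ..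
  have "X.independent {x}" using \<open>x \<noteq> 0\<close> by simp
  then obtain l where l: "Vector_Spaces.linear (scaling X) (*) l" "\<forall>y\<in>{x}. l y = (1 :: 'a)"
    using P.linear_independent_extend[of "{x}" "\<lambda>_. 1"] by blast
  interpret l: Vector_Spaces.linear "scaling X" "(*)" l by (rule l)
  show thesis
    by (rule that[of l]) (use l(2) in \<open>auto simp: linear_map_def scalars_def l.add l.scale\<close>)
qed

lemma tensor_prod_universal:
  fixes V :: "('k::field, 'v::ab_group_add, 'm) lin_space_scheme"
    and W :: "('k, 'w::ab_group_add, 'n) lin_space_scheme"
    and X :: "('k, 'x::ab_group_add, 'l) lin_space_scheme"
  assumes X: "linear_space X" and h: "bilinear_map V W X h"
  obtains L where "linear_map (tensor_prod V W) X L"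
    and "\<And>v w. v \<in> carrier V \<Longrightarrow> w \<in> carrier W \<Longrightarrow> L (tensor V W v w) = h v w"
proof -
  interpret X: vector_space "scaling X" using X by (simp add: linear_space_def)
  have XC: "X.subspace (carrier X)" using X by (simp add: linear_space_def)
  define R where "R t x \<longleftrightarrow> x \<in> carrier X \<and>
    (\<forall>l. linear_map X scalars l \<longrightarrow> l x = t (\<lambda>v w. l (h v w)))" for t x
  have lin0: "l 0 = 0" if "linear_map X scalars l" for l :: "'x \<Rightarrow> 'k"
    using that X.subspace_0[OF XC] unfolding linear_map_def by (metis add_cancel_right_left)
  have R_tensor: "R (tensor V W v w) (h v w)" if "v \<in> carrier V" "w \<in> carrier W" for v w
  proof -
    have "bilinear_map V W scalars (\<lambda>v w. l (h v w))" if "linear_map X scalars l" for l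
      using that h by (auto simp: bilinear_map_def linear_map_def)
    then show ?thesis using that h by (auto simp: R_def tensor_def bilinear_map_def linear_map_def)
  qed
  have R_zero: "R 0 0" using X.subspace_0[OF XC] lin0 by (auto simp: R_def)
  have R_add: "R (s + t) (x + y)" if "R s x" "R t y" for s t x y
    using that X.subspace_add[OF XC] by (auto simp: R_def linear_map_def)
  have R_scale: "R (fun_scaling a t) (scaling X a x)" if "R t x" for a t x
    using that X.subspace_scale[OF XC] by (auto simp: R_def linear_map_def fun_scaling_def scalars_def)
  have R_unique: "x = y" if "R t x" "R t y" for t x y
  proof (rule ccontr)
    assume "x \<noteq> y"
    then have "x - y \<noteq> 0" by simp
    then obtain l where l: "linear_map X scalars l" "l (x - y) \<noteq> 0"
      using separating_functional[OF X] by blast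
    have "x - y \<in> carrier X" using that X.subspace_diff[OF XC] by (simp add: R_def)
    then have "l x = l (x - y) + l y"
      using l(1) that by (metis R_def diff_add_cancel linear_map_def)
    moreover have "l x = l y" using that l(1) by (metis R_def)
    ultimately show False using l(2) by (metis add_cancel_left_left)
  qed
  have R_ex: "\<exists>x. R t x" if "t \<in> carrier (tensor_prod V W)" for t
    using that by (induction rule: tensor_prod_induct) (blast intro: R_tensor R_zero R_add R_scale)+
  define L where "L t = (THE x. R t x)" for t
  have L: "L t = x" if "R t x" for t x
    unfolding L_def using that R_unique by blast
  show thesis
  proof (rule that[of L])
    show "linear_map (tensor_prod V W) X L"
      unfolding linear_map_def
    proof (intro conjI ballI allI)
      fix t assume "t \<in> carrier (tensor_prod V W)"
      then obtain x where x: "R t x" using R_ex by blast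
      then show "L t \<in> carrier X" using L by (metis R_def)
      show "L (scaling (tensor_prod V W) a t) = scaling X a (L t)" for a
        using L[OF R_scale[OF x]] L[OF x] by simp
    next
      fix s t assume "s \<in> carrier (tensor_prod V W)" "t \<in> carrier (tensor_prod V W)"
      then obtain x y where "R s x" "R t y" using R_ex by blast
      then show "L (s + t) = L s + L t" using L[OF R_add] L by auto
    qed
  qed (rule L[OF R_tensor])
qed

lemma tensor_prod_unique:
  assumes X: "linear_space X"
    and L: "linear_map (tensor_prod V W) X L" and M: "linear_map (tensor_prod V W) X M"
    and eq: "\<And>v w. v \<in> carrier V \<Longrightarrow> w \<in> carrier W \<Longrightarrow> L (tensor V W v w) = M (tensor V W v w)"
    and t: "t \<in> carrier (tensor_prod V W)"
  shows "L t = M t"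
proof -
  interpret X: vector_space "scaling X" using X by (simp add: linear_space_def)
  have T: "fun_vs.subspace (carrier (tensor_prod V W))" by (simp add: tensor_prod_def)
  have "t \<in> carrier (tensor_prod V W) \<and> L t = M t"
    using t
  proof (induction rule: tensor_prod_induct)
    case (tensor v w)
    then show ?case using eq by (simp add: tensor_in_tensor_prod)
  next
    case zero
    have "L 0 = 0" if "linear_map (tensor_prod V W) X L" for L
      using that fun_vs.subspace_0[OF T] unfolding linear_map_def by (metis add_cancel_right_left)
    then show ?case using L M fun_vs.subspace_0[OF T] by metis
  next
    case (add s t)
    then show ?case using L M fun_vs.subspace_add[OF T] unfolding linear_map_def by metis
  next
    case (scaling a t)
    then have "L (lin_space.scaling (tensor_prod V W) a t) = M (lin_space.scaling (tensor_prod V W) a t)"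
      using L M by (simp add: linear_map_def)
    then show ?case using scaling fun_vs.subspace_scale[OF T] by (simp add: tensor_prod_def)
  qed
  then show ?thesis by simp
qed


section \<open>Hom-algebras\<close>

text \<open>The linear map from the tensor square given by the multiplication is represented by the
  corresponding bilinear map.\<close>

record ('k, 'a) hom_alg = "('k, 'a) lin_space" +
  mult :: "'a \<Rightarrow> 'a \<Rightarrow> 'a"
  twist :: "'a \<Rightarrow> 'a"

definition hom_algebra :: "('k::field, 'a::ab_group_add) hom_alg \<Rightarrow> bool" where
  "hom_algebra G \<longleftrightarrow>
     linear_space G \<and> bilinear_map G G G (mult G) \<and> linear_map G G (twist G) \<and>
     (\<forall>g\<in>carrier G. \<forall>h\<in>carrier G. \<forall>k\<in>carrier G.
        mult G (twist G g) (mult G h k) = mult G (mult G g h) (twist G k)) \<and>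
     (\<forall>h\<in>carrier G. \<forall>k\<in>carrier G. twist G (mult G h k) = mult G (twist G h) (twist G k))"

definition hom_algebra_morphism ::
  "('k::field, 'a::ab_group_add) hom_alg \<Rightarrow> ('k, 'b::ab_group_add) hom_alg \<Rightarrow> ('a \<Rightarrow> 'b) \<Rightarrow> bool" where
  "hom_algebra_morphism G G' f \<longleftrightarrow>
     linear_map G G' f \<and>
     (\<forall>x\<in>carrier G. \<forall>y\<in>carrier G. mult G' (f x) (f y) = f (mult G x y)) \<and>
     (\<forall>x\<in>carrier G. f (twist G x) = twist G' (f x))"

definition hom_ideal :: "('k::field, 'a::ab_group_add) hom_alg \<Rightarrow> 'a set \<Rightarrow> bool" where
  "hom_ideal G H \<longleftrightarrow>
     H \<subseteq> carrier G \<and> module.subspace (scaling G) H \<and> twist G ` H \<subseteq> H \<and>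
     (\<forall>a\<in>carrier G. \<forall>b\<in>H. mult G a b \<in> H \<and> mult G b a \<in> H)"

text \<open>The quotient \<open>V / H\<close> is spanned by finitely many cosets \<open>b + H\<close>; linear combinations of
  cosets are computed on representatives.\<close>

definition finite_codim :: "('k::field, 'v::ab_group_add, 'm) lin_space_scheme \<Rightarrow> 'v set \<Rightarrow> bool" where
  "finite_codim V H \<longleftrightarrow>
     (\<exists>B. finite B \<and> B \<subseteq> carrier V \<and>
        (\<forall>x\<in>carrier V. \<exists>c. (+) x ` H = (+) (\<Sum>b\<in>B. scaling V (c b) b) ` H))"


section \<open>Hom-coalgebras\<close>

record ('k, 'c) hom_coalg = "('k, 'c) lin_space" +
  comult :: "'c \<Rightarrow> ('k, 'c, 'c) tensor"
  cotwist :: "'c \<Rightarrow> 'c"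

definition hom_coalgebra :: "('k::field, 'c::ab_group_add) hom_coalg \<Rightarrow> bool" where
  "hom_coalgebra C \<longleftrightarrow>
     linear_space C \<and> linear_map C (tensor_prod C C) (comult C) \<and> linear_map C C (cotwist C) \<and>
     (\<forall>c\<in>carrier C.
        tensor_map C (tensor_prod C C) (cotwist C) (comult C) (comult C c) =
        tensor_assoc C C C (tensor_map (tensor_prod C C) C (comult C) (cotwist C) (comult C c))) \<and>
     (\<forall>c\<in>carrier C. comult C (cotwist C c) = tensor_map C C (cotwist C) (cotwist C) (comult C c))"

definition hom_coalgebra_morphism ::
  "('k::field, 'c::ab_group_add) hom_coalg \<Rightarrow> ('k, 'd::ab_group_add) hom_coalg \<Rightarrow> ('c \<Rightarrow> 'd) \<Rightarrow> bool" where
  "hom_coalgebra_morphism C D f \<longleftrightarrow>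
     hom_coalgebra C \<and> hom_coalgebra D \<and> linear_map C D f \<and>
     (\<forall>c\<in>carrier C. f (cotwist C c) = cotwist D (f c)) \<and>
     (\<forall>c\<in>carrier C. comult D (f c) = tensor_map D D f f (comult C c))"


section \<open>The Sweedler dual\<close>

definition sweedler_set :: "('k::field, 'a::ab_group_add) hom_alg \<Rightarrow> ('a \<Rightarrow> 'k) set" where
  "sweedler_set G =
     {\<phi> \<in> dual_space G.
        \<exists>J. hom_ideal G J \<and> finite_codim G J \<and> J \<subseteq> {x \<in> carrier G. \<phi> x = 0}}"

definition sweedler_space :: "('k::field, 'a::ab_group_add) hom_alg \<Rightarrow> ('k, 'a \<Rightarrow> 'k) lin_space" where
  "sweedler_space G = \<lparr>carrier = sweedler_set G, scaling = fun_scaling\<rparr>"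

text \<open>The value at the tensor of \<open>x\<close> and \<open>y\<close> of a tensor of functionals, so that the tensor of
  \<open>\<phi>\<close> and \<open>\<chi>\<close> has the value \<open>\<phi> x * \<chi> y\<close>. Through this pairing tensors of functionals on \<open>G\<close>
  are regarded as linear forms on the tensor square of \<open>G\<close>.\<close>

definition pairing :: "('k::field, 'a \<Rightarrow> 'k, 'a \<Rightarrow> 'k) tensor \<Rightarrow> 'a \<Rightarrow> 'a \<Rightarrow> 'k" where
  "pairing t x y = t (\<lambda>\<phi> \<chi>. \<phi> x * \<chi> y)"

lemma pairing_tensor:
  assumes "\<phi> \<in> sweedler_set G" "\<chi> \<in> sweedler_set G"
  shows "pairing (tensor (sweedler_space G) (sweedler_space G) \<phi> \<chi>) x y = \<phi> x * \<chi> y"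
  by (auto simp: pairing_def tensor_def bilinear_map_def linear_map_def scalars_def
      sweedler_space_def fun_scaling_def algebra_simps)

text \<open>The comultiplication sends \<open>\<phi>\<close> to the tensor in the tensor square of the Sweedler dual that
  represents the form mapping the tensor of \<open>x\<close> and \<open>y\<close> to \<open>\<phi> (x y)\<close>.\<close>

definition sweedler_comult ::
  "('k::field, 'a::ab_group_add) hom_alg \<Rightarrow> ('a \<Rightarrow> 'k) \<Rightarrow> ('k, 'a \<Rightarrow> 'k, 'a \<Rightarrow> 'k) tensor" where
  "sweedler_comult G \<phi> =
     (THE t. t \<in> carrier (tensor_prod (sweedler_space G) (sweedler_space G)) \<and>
             (\<forall>x\<in>carrier G. \<forall>y\<in>carrier G. pairing t x y = \<phi> (mult G x y)))"

definition sweedler_dual :: "('k::field, 'a::ab_group_add) hom_alg \<Rightarrow> ('k, 'a \<Rightarrow> 'k) hom_coalg" where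
  "sweedler_dual G =
     \<lparr>carrier = sweedler_set G, scaling = fun_scaling,
      comult = sweedler_comult G, cotwist = dual_map G (twist G)\<rparr>"

end

theory Submission
  imports Defs
begin

text \<open>A tensor of functionals is determined by its values on pairs, and an element of
  \<open>G\<^sup>\<circ> \<otimes> (G\<^sup>\<circ> \<otimes> G\<^sup>\<circ>)\<close> by its values on triples, because evaluations separate functionals.
  Hence every Hom-coalgebra identity reduces to the corresponding identity in \<open>G\<close>, once the
  comultiplication is known to exist; existence comes from coordinate functionals modulo a
  finite-codimensional ideal in the kernel. The preimage of such an ideal under \<open>f\<close> is again a
  finite-codimensional ideal, so \<open>f\<^sup>\<circ>\<close> maps \<open>G'\<^sup>\<circ>\<close> to \<open>G\<^sup>\<circ>\<close>.\<close>

section \<open>Linear maps between carriers\<close>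

lemma linear_space_vector_space: "linear_space V \<Longrightarrow> vector_space (scaling V)"
  by (simp add: linear_space_def)

lemma linear_space_module: "linear_space V \<Longrightarrow> module (scaling V)"
  by (simp add: linear_space_def module_iff_vector_space)

lemma linear_space_subspace: "linear_space V \<Longrightarrow> module.subspace (scaling V) (carrier V)"
  by (simp add: linear_space_def)

lemma linear_space_0: "linear_space V \<Longrightarrow> 0 \<in> carrier V"
  and linear_space_add: "linear_space V \<Longrightarrow> v \<in> carrier V \<Longrightarrow> w \<in> carrier V \<Longrightarrow> v + w \<in> carrier V"
  and linear_space_diff: "linear_space V \<Longrightarrow> v \<in> carrier V \<Longrightarrow> w \<in> carrier V \<Longrightarrow> v - w \<in> carrier V"
  and linear_space_scale: "linear_space V \<Longrightarrow> v \<in> carrier V \<Longrightarrow> scaling V a v \<in> carrier V"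
  and linear_space_sum: "linear_space V \<Longrightarrow> (\<And>i. i \<in> I \<Longrightarrow> h i \<in> carrier V) \<Longrightarrow> sum h I \<in> carrier V"
  using linear_space_module[of V] linear_space_subspace[of V]
  by (auto intro: module.subspace_0 module.subspace_add module.subspace_diff module.subspace_scale
      module.subspace_sum)

lemmas linear_space_closed =
  linear_space_0 linear_space_add linear_space_diff linear_space_scale linear_space_sum

lemma scalars_simps [simp]: "carrier scalars = UNIV" "scaling scalars = (*)"
  by (simp_all add: scalars_def)

lemma linear_map_in: "linear_map V W f \<Longrightarrow> v \<in> carrier V \<Longrightarrow> f v \<in> carrier W"
  and linear_map_add:
    "linear_map V W f \<Longrightarrow> v \<in> carrier V \<Longrightarrow> v' \<in> carrier V \<Longrightarrow> f (v + v') = f v + f v'"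
  and linear_map_scale:
    "linear_map V W f \<Longrightarrow> v \<in> carrier V \<Longrightarrow> f (scaling V a v) = scaling W a (f v)"
  by (auto simp: linear_map_def)

lemma linear_map_0: "linear_space V \<Longrightarrow> linear_map V W f \<Longrightarrow> f 0 = 0"
  using linear_map_add[of V W f 0 0] linear_space_0[of V] by simp

lemma linear_map_diff:
  assumes "linear_space V" "linear_map V W f" "v \<in> carrier V" "v' \<in> carrier V"
  shows "f (v - v') = f v - f v'"
  using linear_map_add[OF assms(2), of "v - v'" v'] linear_space_diff[OF assms(1)] assms(3,4)
  by (simp add: eq_diff_eq)

lemma linear_map_sum:
  assumes V: "linear_space V" and f: "linear_map V W f" and h: "\<And>i. i \<in> I \<Longrightarrow> h i \<in> carrier V"
  shows "f (sum h I) = (\<Sum>i\<in>I. f (h i))"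
  using h
proof (induction I rule: infinite_finite_induct)
  case (insert i I)
  then show ?case
    using linear_map_add[OF f, of "h i" "sum h I"] linear_space_sum[OF V, of I h] by simp
qed (simp_all add: linear_map_0[OF V f])

lemma bilinear_map_left: "bilinear_map V W X h \<Longrightarrow> v \<in> carrier V \<Longrightarrow> linear_map W X (h v)"
  and bilinear_map_right: "bilinear_map V W X h \<Longrightarrow> w \<in> carrier W \<Longrightarrow> linear_map V X (\<lambda>v. h v w)"
  by (simp_all add: bilinear_map_def)


section \<open>Tensors separated by functionals\<close>

lemmas tensor_left = bilinear_map_right[OF bilinear_tensor]
lemmas tensor_right = bilinear_map_left[OF bilinear_tensor]

text \<open>Expanding the left factor over the basis \<open>A\<close> and moving the coordinates
  across the tensor sign leaves basis vectors on the left and arbitrary vectors of \<open>W\<close>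
  on the right. In this form a tensor has coefficients, which \<open>tensor_eq_0I\<close> shows to
  be zero one at a time.\<close>

lemma tensor_prod_decomp:
  fixes V :: "('k::field, 'v::ab_group_add, 'm) lin_space_scheme"
    and W :: "('k, 'w::ab_group_add, 'n) lin_space_scheme"
  assumes V: "linear_space V" and W: "linear_space W"
    and indep: "\<not> module.dependent (scaling V) A" and span: "module.span (scaling V) A = carrier V"
    and t: "t \<in> carrier (tensor_prod V W)"
  shows "\<exists>F g. finite F \<and> F \<subseteq> A \<and> (\<forall>b\<in>F. g b \<in> carrier W) \<and> t = (\<Sum>b\<in>F. tensor V W b (g b))"
  using t
proof (induction rule: tensor_prod_induct)
  case (tensor v w)
  interpret V: vector_space "scaling V" using V by (rule linear_space_vector_space)
  let ?c = "V.representation A v"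
  \<comment> \<open>Only the basis vectors in the support of \<open>v\<close> occur, so the index
    set is finite even if \<open>A\<close> is infinite.\<close>
  let ?F = "{b. ?c b \<noteq> 0}"
  have F: "finite ?F" by (rule V.finite_representation)
  have FA: "?F \<subseteq> A" using V.representation_ne_zero by blast
  then have FV: "b \<in> carrier V" if "b \<in> ?F" for b using that span V.span_base by blast
  have v: "v = (\<Sum>b\<in>?F. scaling V (?c b) b)"
    using V.sum_nonzero_representation_eq[OF indep] tensor(1) span by simp
  have "tensor V W v w = (\<Sum>b\<in>?F. tensor V W (scaling V (?c b) b) w)"
    by (subst v, rule linear_map_sum[OF V tensor_left[OF tensor(2)]])
      (simp add: FV linear_space_scale[OF V])
  also have "\<dots> = (\<Sum>b\<in>?F. tensor V W b (scaling W (?c b) w))"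
    by (rule sum.cong) (simp_all add: linear_map_scale[OF tensor_left[OF tensor(2)]]
        linear_map_scale[OF tensor_right] FV tensor(2))
  finally show ?case
    using F FA linear_space_scale[OF W tensor(2)]
    by (intro exI[of _ ?F] exI[of _ "\<lambda>b. scaling W (?c b) w"]) simp
next
  case zero
  show ?case by (intro exI[of _ "{}"]) simp
next
  case (add s t)
  interpret V: vector_space "scaling V" using V by (rule linear_space_vector_space)
  from add obtain F g F' g' where
    F: "finite F" "F \<subseteq> A" "\<forall>b\<in>F. g b \<in> carrier W" "s = (\<Sum>b\<in>F. tensor V W b (g b))" and
    F': "finite F'" "F' \<subseteq> A" "\<forall>b\<in>F'. g' b \<in> carrier W" "t = (\<Sum>b\<in>F'. tensor V W b (g' b))"
    by auto
  \<comment> \<open>Coefficients extended by 0, so that both sums can be taken over the common index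
    set \<open>F \<union> F'\<close>.\<close>
  define h where "h b = (if b \<in> F then g b else 0)" for b
  define h' where "h' b = (if b \<in> F' then g' b else 0)" for b
  have hW: "h b \<in> carrier W" "h' b \<in> carrier W" for b
    using F(3) F'(3) linear_space_0[OF W] by (auto simp: h_def h'_def)
  have FV: "b \<in> carrier V" if "b \<in> F \<union> F'" for b
    using that span V.span_base F(2) F'(2) by blast
  have t0: "tensor V W b 0 = 0" if "b \<in> F \<union> F'" for b
    using linear_map_0[OF W tensor_right[OF FV[OF that]]] .
  have "s = (\<Sum>b\<in>F \<union> F'. tensor V W b (h b))"
    unfolding F(4) using F(1) F'(1) t0 by (intro sum.mono_neutral_cong_left) (auto simp: h_def)
  moreover have "t = (\<Sum>b\<in>F \<union> F'. tensor V W b (h' b))"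
    unfolding F'(4) using F(1) F'(1) t0 by (intro sum.mono_neutral_cong_left) (auto simp: h'_def)
  ultimately have "s + t = (\<Sum>b\<in>F \<union> F'. tensor V W b (h b + h' b))"
    using FV hW by (simp add: sum.distrib linear_map_add[OF tensor_right])
  then show ?case
    using F(1,2) F'(1,2) linear_space_add[OF W hW]
    by (intro exI[of _ "F \<union> F'"] exI[of _ "\<lambda>b. h b + h' b"]) simp
next
  case (scaling a t)
  interpret V: vector_space "lin_space.scaling V" using V by (rule linear_space_vector_space)
  from scaling obtain F g where
    F: "finite F" "F \<subseteq> A" "\<forall>b\<in>F. g b \<in> carrier W" "t = (\<Sum>b\<in>F. tensor V W b (g b))"
    by auto
  have FV: "b \<in> carrier V" if "b \<in> F" for b
    using that span V.span_base F(2) by blast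
  have "fun_scaling a t = (\<Sum>b\<in>F. tensor V W b (lin_space.scaling W a (g b)))"
    using F FV by (simp add: fun_vs.scale_sum_right linear_map_scale[OF tensor_right])
  then show ?case
    using F linear_space_scale[OF W]
    by (intro exI[of _ F] exI[of _ "\<lambda>b. lin_space.scaling W a (g b)"]) simp
qed

lemma sum_fun_apply: "sum h I x = (\<Sum>i\<in>I. h i x)"
  for h :: "'i \<Rightarrow> 'b \<Rightarrow> 'c::comm_monoid_add"
  by (induction I rule: infinite_finite_induct) simp_all

lemma bilinear_map_mult:
  assumes "linear_map V scalars d" "linear_map W scalars e"
  shows "bilinear_map V W scalars (\<lambda>v w. d v * e w)"
  using assms by (auto simp: bilinear_map_def linear_map_def algebra_simps)

lemma tensor_mult:
  assumes "linear_map V scalars d" "linear_map W scalars e"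
  shows "tensor V W v w (\<lambda>v w. d v * e w) = d v * e w"
  using bilinear_map_mult[OF assms] by (simp add: tensor_def)

text \<open>Writing the tensor over a basis of \<open>V\<close>, separation by \<open>D\<close> and linear independence of the
  basis kill every coefficient after \<open>e \<in> E\<close> is applied, so separation by \<open>E\<close> kills the
  coefficients themselves.\<close>

lemma tensor_eq_0I:
  fixes V :: "('k::field, 'v::ab_group_add, 'm) lin_space_scheme"
    and W :: "('k, 'w::ab_group_add, 'n) lin_space_scheme"
  assumes V: "linear_space V" and W: "linear_space W"
    and D: "\<And>d. d \<in> D \<Longrightarrow> linear_map V scalars d" and E: "\<And>e. e \<in> E \<Longrightarrow> linear_map W scalars e"
    and sepD: "\<And>v. v \<in> carrier V \<Longrightarrow> \<forall>d\<in>D. d v = 0 \<Longrightarrow> v = 0"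
    and sepE: "\<And>w. w \<in> carrier W \<Longrightarrow> \<forall>e\<in>E. e w = 0 \<Longrightarrow> w = 0"
    and t: "t \<in> carrier (tensor_prod V W)"
    and t0: "\<And>d e. d \<in> D \<Longrightarrow> e \<in> E \<Longrightarrow> t (\<lambda>v w. d v * e w) = 0"
  shows "t = 0"
proof -
  interpret V: vector_space "scaling V" using V by (rule linear_space_vector_space)
  obtain A where A: "A \<subseteq> carrier V" "V.independent A" "carrier V \<subseteq> V.span A"
    using V.maximal_independent_subset by blast
  then have "V.span A = carrier V"
    using V.span_minimal[OF A(1) linear_space_subspace[OF V]] by blast
  from tensor_prod_decomp[OF V W A(2) this t] obtain F g where
    F: "finite F" "F \<subseteq> A" "\<forall>b\<in>F. g b \<in> carrier W" "t = (\<Sum>b\<in>F. tensor V W b (g b))"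
    by blast
  have indep: "V.independent F" using A(2) F(2) V.independent_mono by blast
  have FV: "b \<in> carrier V" if "b \<in> F" for b using that F(2) A(1) by blast
  have g0: "e (g b) = 0" if e: "e \<in> E" and "b \<in> F" for e b
  proof -
    \<comment> \<open>The contraction of \<open>t\<close> with \<open>e\<close> in the right factor;
      applying \<open>d\<close> to it gives the value of \<open>t\<close> at the product of
      \<open>d\<close> and \<open>e\<close>.\<close>
    let ?v = "\<Sum>b\<in>F. scaling V (e (g b)) b"
    have "d ?v = 0" if d: "d \<in> D" for d
    proof -
      have "d ?v = (\<Sum>b\<in>F. d b * e (g b))"
        using FV by (simp add: linear_map_sum[OF V D[OF d]] linear_space_scale[OF V]
            linear_map_scale[OF D[OF d]] mult.commute)
      also have "\<dots> = t (\<lambda>v w. d v * e w)"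
        by (simp add: F(4) sum_fun_apply tensor_mult[OF D[OF d] E[OF e]])
      finally show ?thesis using t0[OF d e] by simp
    qed
    then have "?v = 0" using sepD FV by (simp add: linear_space_sum[OF V] linear_space_scale[OF V])
    then show ?thesis using V.independentD[OF indep F(1) subset_refl, of "\<lambda>b. e (g b)" b] \<open>b \<in> F\<close> by blast
  qed
  have "tensor V W b (g b) = 0" if "b \<in> F" for b
  proof -
    have "g b = 0" using g0 that F(3) sepE by blast
    then show ?thesis using linear_map_0[OF W tensor_right[OF FV[OF that]]] by simp
  qed
  then show ?thesis using F(4) by simp
qed

section \<open>Closure properties and linearity of \<open>tensor_map\<close> and
  \<open>tensor_assoc\<close>\<close>

lemma tensor_prod_closed:
  "0 \<in> carrier (tensor_prod V W)"
  "s \<in> carrier (tensor_prod V W) \<Longrightarrow> t \<in> carrier (tensor_prod V W) \<Longrightarrow> s + t \<in> carrier (tensor_prod V W)"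
  "t \<in> carrier (tensor_prod V W) \<Longrightarrow> fun_scaling a t \<in> carrier (tensor_prod V W)"
  using linear_space_closed[OF linear_space_tensor_prod[of V W]] by (simp_all add: tensor_prod_def)

text \<open>Both \<open>tensor_map\<close> and \<open>tensor_assoc\<close> evaluate the given tensor
  at a form that does not depend on it, so linearity is pointwise and holds for arbitrary functions
  \<open>s\<close> and \<open>t\<close>.\<close>

lemma tensor_map_linear:
  "tensor_map V' W' f g 0 = 0"
  "tensor_map V' W' f g (s + t) = tensor_map V' W' f g s + tensor_map V' W' f g t"
  "tensor_map V' W' f g (fun_scaling a t) = fun_scaling a (tensor_map V' W' f g t)"
  by (auto simp: tensor_map_def fun_scaling_def fun_eq_iff)

lemma tensor_assoc_linear:
  "tensor_assoc U V W 0 = 0"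
  "tensor_assoc U V W (s + t) = tensor_assoc U V W s + tensor_assoc U V W t"
  "tensor_assoc U V W (fun_scaling a t) = fun_scaling a (tensor_assoc U V W t)"
  by (auto simp: tensor_assoc_def fun_scaling_def fun_eq_iff)

text \<open>Rule induction eta-expands the tensors \<open>0\<close> and \<open>s + t\<close>; the pointwise rules would then
  rewrite under the abstraction and destroy them, hence their deletion.\<close>

lemma tensor_map_in:
  assumes f: "linear_map V V' f" and g: "linear_map W W' g" and t: "t \<in> carrier (tensor_prod V W)"
  shows "tensor_map V' W' f g t \<in> carrier (tensor_prod V' W')"
  using t
proof (induction rule: tensor_prod_induct)
  case (tensor v w)
  then show ?case
    by (simp add: tensor_map_tensor[OF f g] tensor_in_tensor_prod linear_map_in[OF f] linear_map_in[OF g])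
qed (simp_all add: tensor_map_linear tensor_prod_closed del: zero_fun_apply plus_fun_apply)

text \<open>\<open>tensor_assoc_tensor\<close> handles only pure tensors of pure tensors. An outer
  induction reduces to a pure tensor of \<open>s\<close> and \<open>w\<close>, an inner one reduces
  \<open>s\<close> to a pure tensor.\<close>

lemma tensor_assoc_in:
  assumes W: "linear_space W" and t: "t \<in> carrier (tensor_prod (tensor_prod U V) W)"
  shows "tensor_assoc U V W t \<in> carrier (tensor_prod U (tensor_prod V W))"
  using t
proof (induction rule: tensor_prod_induct)
  case (tensor s w)
  note L = tensor_left[OF tensor(2), of "tensor_prod U V"]
  \<comment> \<open>Membership of \<open>s\<close> is carried through the induction because
    additivity of the tensor in its left argument is known only on the carrier.\<close>
  have "s \<in> carrier (tensor_prod U V) \<and>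
      tensor_assoc U V W (tensor (tensor_prod U V) W s w) \<in> carrier (tensor_prod U (tensor_prod V W))"
    using tensor(1)
  proof (induction rule: tensor_prod_induct)
    case (tensor u v)
    then show ?case
      by (simp add: tensor_assoc_tensor[OF W] tensor_in_tensor_prod \<open>w \<in> carrier W\<close>)
  next
    case zero
    show ?case
      by (simp add: linear_map_0[OF linear_space_tensor_prod L] tensor_assoc_linear tensor_prod_closed
        del: zero_fun_apply plus_fun_apply)
  next
    case (add s t)
    then show ?case
      by (simp add: linear_map_add[OF L] tensor_assoc_linear tensor_prod_closed
        del: zero_fun_apply plus_fun_apply)
  next
    case (scaling a s)
    then show ?case
      using linear_map_scale[OF L, of s a] by (simp add: tensor_assoc_linear tensor_prod_closed
        del: zero_fun_apply plus_fun_apply)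
  qed
  then show ?case by simp
qed (simp_all add: tensor_assoc_linear tensor_prod_closed del: zero_fun_apply plus_fun_apply)


section \<open>Finite codimension\<close>

lemma coset_eq_iff:
  assumes "module scale" "module.subspace scale H"
  shows "(+) x ` H = (+) y ` H \<longleftrightarrow> x - y \<in> H"
proof -
  interpret module scale by fact
  note H = \<open>module.subspace scale H\<close>
  show ?thesis
  proof
    assume "(+) x ` H = (+) y ` H"
    moreover have "x + 0 \<in> (+) x ` H" using subspace_0[OF H] by blast
    ultimately obtain h where "h \<in> H" "x = y + h" by auto
    then show "x - y \<in> H" by simp
  next
    have *: "(+) x ` H \<subseteq> (+) y ` H" if "x - y \<in> H" for x y
    proof
      fix z assume "z \<in> (+) x ` H"
      then obtain h where "h \<in> H" "z = x + h" by auto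
      then have "z = y + ((x - y) + h)" "(x - y) + h \<in> H" using subspace_add[OF H that] by simp_all
      then show "z \<in> (+) y ` H" by blast
    qed
    assume xy: "x - y \<in> H"
    then have "y - x \<in> H" using subspace_neg[OF H xy] by simp
    then show "(+) x ` H = (+) y ` H" using * xy by blast
  qed
qed

text \<open>Equality of cosets becomes membership of a difference, so that no quotient space has to
  be handled later.\<close>

lemma finite_codim_iff_span:
  assumes V: "linear_space V" and H: "module.subspace (scaling V) H"
  shows "finite_codim V H \<longleftrightarrow>
    (\<exists>B. finite B \<and> B \<subseteq> carrier V \<and>
       (\<forall>x\<in>carrier V. \<exists>s\<in>module.span (scaling V) B. x - s \<in> H))"
proof -
  interpret V: vector_space "scaling V" using V by (rule linear_space_vector_space)
  have "(\<exists>c. (+) x ` H = (+) (\<Sum>b\<in>B. scaling V (c b) b) ` H) \<longleftrightarrow> (\<exists>s\<in>V.span B. x - s \<in> H)"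
    if "finite B" for B x
    using that by (auto simp: coset_eq_iff[OF linear_space_module[OF V] H] V.span_finite)
  then show ?thesis unfolding finite_codim_def by (simp cong: conj_cong)
qed

text \<open>A basis of \<open>H\<close> is extended to a basis of \<open>V\<close> by finitely many
  vectors \<open>F\<close>. The coordinate functionals at \<open>F\<close> vanish on
  \<open>H\<close> and determine a vector modulo \<open>H\<close>.\<close>

lemma finite_codim_functionals:
  fixes V :: "('k::field, 'v::ab_group_add, 'm) lin_space_scheme"
  assumes V: "linear_space V" and H: "module.subspace (scaling V) H" "H \<subseteq> carrier V"
    and fin: "finite_codim V H"
  obtains F l where "finite F" "F \<subseteq> carrier V" "\<And>b. b \<in> F \<Longrightarrow> l b \<in> dual_space V"
    "\<And>b h. b \<in> F \<Longrightarrow> h \<in> H \<Longrightarrow> l b h = 0"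
    "\<And>x. x \<in> carrier V \<Longrightarrow> x - (\<Sum>b\<in>F. scaling V (l b x) b) \<in> H"
proof -
  interpret V: vector_space "scaling V" using V by (rule linear_space_vector_space)
  obtain B where B: "finite B" "B \<subseteq> carrier V" "\<And>x. x \<in> carrier V \<Longrightarrow> \<exists>s\<in>V.span B. x - s \<in> H"
    using fin finite_codim_iff_span[OF V H(1)] by blast
  obtain BH where BH: "BH \<subseteq> H" "V.independent BH" "H \<subseteq> V.span BH"
    using V.maximal_independent_subset by blast
  have span_BH: "V.span BH = H" using V.span_minimal[OF BH(1) H(1)] BH(3) by blast
  \<comment> \<open>Since \<open>A\<close> is taken inside \<open>BH \<union> B\<close>, the vectors
    added to \<open>BH\<close> lie in \<open>B\<close> and are finite in number.\<close>
  obtain A where A: "BH \<subseteq> A" "A \<subseteq> BH \<union> B" "V.independent A" "BH \<union> B \<subseteq> V.span A"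
    using V.maximal_independent_subset_extend[of BH "BH \<union> B"] BH(2) by blast
  have span_A: "V.span A = carrier V"
  proof
    show "V.span A \<subseteq> carrier V"
      using A(2) B(2) BH(1) H(2) by (intro V.span_minimal linear_space_subspace[OF V]) blast
    show "carrier V \<subseteq> V.span A"
    proof
      fix x assume "x \<in> carrier V"
      then obtain s where s: "s \<in> V.span B" "x - s \<in> H" using B(3) by blast
      have "s \<in> V.span A" using s(1) A(4) V.span_minimal[of B "V.span A"] by auto
      moreover have "x - s \<in> V.span A" using s(2) span_BH V.span_mono[OF A(1)] by blast
      ultimately have "(x - s) + s \<in> V.span A" by (intro V.span_add)
      then show "x \<in> V.span A" by simp
    qed
  qed
  define F where "F = A - BH"
  define l where "l b x = V.representation A x b" for b x
  have finF: "finite F" using A(2) B(1) by (auto simp: F_def intro: finite_subset)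
  show thesis
  proof (rule that[of F l, OF finF])
    show "F \<subseteq> carrier V" using span_A V.span_superset by (auto simp: F_def)
    \<comment> \<open>By convention \<open>representation\<close> is zero outside the span, which is
      the extension by zero that \<open>dual_space\<close> asks for.\<close>
    have "V.representation A x = (\<lambda>_. 0)" if "x \<notin> carrier V" for x
      using that span_A by (simp add: V.representation_def)
    then show "l b \<in> dual_space V" for b
      by (auto simp: dual_space_def linear_map_def l_def V.representation_add[OF A(3)]
          V.representation_scale[OF A(3)] span_A)
    \<comment> \<open>The coordinates of \<open>h\<close> over \<open>A\<close> are those over
      \<open>BH\<close>, and \<open>b\<close> is not in \<open>BH\<close>.\<close>
    show "l b h = 0" if "b \<in> F" "h \<in> H" for b h
      using V.representation_extend[OF A(3) _ A(1), of h] that span_BH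
        V.representation_ne_zero[of BH h b] by (auto simp: l_def F_def)
    show "x - (\<Sum>b\<in>F. scaling V (l b x) b) \<in> H" if x: "x \<in> carrier V" for x
    proof -
      let ?N = "{b. l b x \<noteq> 0}"
      have finN: "finite ?N" unfolding l_def by (rule V.finite_representation)
      have "?N \<subseteq> A" using V.representation_ne_zero by (auto simp: l_def)
      \<comment> \<open>The part of the expansion over \<open>BH\<close> is the remainder claimed to
        lie in \<open>H\<close>.\<close>
      then have N: "?N = ?N \<inter> BH \<union> ?N \<inter> F" by (auto simp: F_def)
      have "x = (\<Sum>b\<in>?N. scaling V (l b x) b)"
        using V.sum_nonzero_representation_eq[OF A(3)] x span_A by (simp add: l_def)
      also have "\<dots> = (\<Sum>b\<in>?N \<inter> BH. scaling V (l b x) b) + (\<Sum>b\<in>?N \<inter> F. scaling V (l b x) b)"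
        by (subst N, rule sum.union_disjoint) (use finN in \<open>auto simp: F_def\<close>)
      also have "(\<Sum>b\<in>?N \<inter> F. scaling V (l b x) b) = (\<Sum>b\<in>F. scaling V (l b x) b)"
        by (rule sum.mono_neutral_left) (use finF in auto)
      finally have "x - (\<Sum>b\<in>F. scaling V (l b x) b) = (\<Sum>b\<in>?N \<inter> BH. scaling V (l b x) b)"
        by (simp add: algebra_simps)
      also have "\<dots> \<in> H"
        using BH(1) by (intro V.subspace_sum[OF H(1)] V.subspace_scale[OF H(1)]) blast
      finally show ?thesis .
    qed
  qed
qed

text \<open>Each further functional costs at most one more spanning vector for the quotient by the
  common kernel, hence the induction on \<open>L\<close>.\<close>

lemma finite_codim_if_functionals:
  fixes V :: "('k::field, 'v::ab_group_add, 'm) lin_space_scheme"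
  assumes V: "linear_space V" and H: "module.subspace (scaling V) H"
    and fin: "finite L" and L: "\<And>l. l \<in> L \<Longrightarrow> linear_map V scalars l"
    and sub: "\<And>x. x \<in> carrier V \<Longrightarrow> \<forall>l\<in>L. l x = 0 \<Longrightarrow> x \<in> H"
  shows "finite_codim V H"
proof -
  interpret V: vector_space "scaling V" using V by (rule linear_space_vector_space)
  have "\<exists>B. finite B \<and> B \<subseteq> carrier V \<and>
      (\<forall>x\<in>carrier V. \<exists>s\<in>V.span B. \<forall>l\<in>L. l (x - s) = 0)"
    using fin L
  proof (induction L rule: finite_induct)
    case empty
    show ?case by (intro exI[of _ "{}"]) auto
  next
    case (insert l L)
    have "\<exists>B. finite B \<and> B \<subseteq> carrier V \<and>
        (\<forall>x\<in>carrier V. \<exists>s\<in>V.span B. \<forall>l\<in>L. l (x - s) = 0)"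
      by (rule insert.IH) (simp add: insert.prems)
    then obtain B where B: "finite B" "B \<subseteq> carrier V"
      "\<And>x. x \<in> carrier V \<Longrightarrow> \<exists>s\<in>V.span B. \<forall>l\<in>L. l (x - s) = 0"
      by blast
    have BV: "V.span B \<subseteq> carrier V" by (rule V.span_minimal[OF B(2) linear_space_subspace[OF V]])
    show ?case
    proof (cases "\<exists>v\<in>carrier V. l v \<noteq> 0 \<and> (\<forall>l\<in>L. l v = 0)")
      case True
      then obtain v where v: "v \<in> carrier V" "l v \<noteq> 0" "\<forall>l\<in>L. l v = 0" by blast
      have "\<exists>s\<in>V.span (insert v B). \<forall>l\<in>insert l L. l (x - s) = 0" if x: "x \<in> carrier V" for x
      proof -
        obtain s where s: "s \<in> V.span B" "\<forall>l\<in>L. l (x - s) = 0" using B(3)[OF x] by blast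
        \<comment> \<open>Subtracting this multiple of \<open>v\<close> cancels the value of
          \<open>l\<close>, while the functionals in \<open>L\<close> do not see
          \<open>v\<close>.\<close>
        define a where "a = l (x - s) / l v"
        have xs: "x - s \<in> carrier V" using x s(1) BV by (blast intro: linear_space_diff[OF V])
        have "l' (x - (s + scaling V a v)) = l' (x - s) - a * l' v" if "l' \<in> insert l L" for l'
          using linear_map_diff[OF V insert.prems[OF that] xs linear_space_scale[OF V v(1), of a]]
            linear_map_scale[OF insert.prems[OF that] v(1), of a] by (simp add: diff_diff_eq)
        moreover have "l' (x - s) - a * l' v = 0" if "l' \<in> insert l L" for l'
          using that s(2) v(2,3) by (auto simp: a_def)
        ultimately have "\<forall>l'\<in>insert l L. l' (x - (s + scaling V a v)) = 0" by metis
        moreover have "s + scaling V a v \<in> V.span (insert v B)"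
        proof (rule V.span_add)
          show "s \<in> V.span (insert v B)" using s(1) V.span_mono[of B "insert v B"] by blast
          show "scaling V a v \<in> V.span (insert v B)" by (simp add: V.span_base V.span_scale)
        qed
        ultimately show ?thesis by blast
      qed
      then show ?thesis using B(1,2) v(1) by (intro exI[of _ "insert v B"]) auto
    next
      \<comment> \<open>Now \<open>l\<close> vanishes on the common kernel of \<open>L\<close>, so
        the old \<open>B\<close> already serves.\<close>
      case False
      have "\<exists>s\<in>V.span B. \<forall>l\<in>insert l L. l (x - s) = 0" if x: "x \<in> carrier V" for x
      proof -
        obtain s where s: "s \<in> V.span B" "\<forall>l\<in>L. l (x - s) = 0" using B(3)[OF x] by blast
        have "x - s \<in> carrier V" using x s(1) BV by (blast intro: linear_space_diff[OF V])
        then have "l (x - s) = 0" using False s(2) by blast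
        then show ?thesis using s by auto
      qed
      then show ?thesis using B(1,2) by blast
    qed
  qed
  then obtain B where B: "finite B" "B \<subseteq> carrier V"
    "\<And>x. x \<in> carrier V \<Longrightarrow> \<exists>s\<in>V.span B. \<forall>l\<in>L. l (x - s) = 0" by blast
  have BV: "V.span B \<subseteq> carrier V" by (rule V.span_minimal[OF B(2) linear_space_subspace[OF V]])
  have "\<exists>s\<in>V.span B. x - s \<in> H" if "x \<in> carrier V" for x
    using B(3)[OF that] sub linear_space_diff[OF V that] BV by blast
  then show ?thesis using B(1,2) by (auto simp: finite_codim_iff_span[OF V H])
qed

text \<open>Together with \<open>finite_codim_if_functionals\<close> this characterises finite
  codimension: the subspace contains the common kernel of finitely many functionals. Intersections
  and preimages are then treated by taking unions of, or composing, functionals.\<close>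

lemma finite_codim_kernels:
  assumes V: "linear_space V" and H: "module.subspace (scaling V) H" "H \<subseteq> carrier V"
    and fin: "finite_codim V H"
  obtains L where "finite L" "\<And>l. l \<in> L \<Longrightarrow> linear_map V scalars l"
    "\<And>x. x \<in> carrier V \<Longrightarrow> \<forall>l\<in>L. l x = 0 \<Longrightarrow> x \<in> H"
proof -
  interpret V: vector_space "scaling V" using V by (rule linear_space_vector_space)
  obtain F l where F: "finite F" "F \<subseteq> carrier V" "\<And>b. b \<in> F \<Longrightarrow> l b \<in> dual_space V"
    "\<And>b h. b \<in> F \<Longrightarrow> h \<in> H \<Longrightarrow> l b h = 0"
    "\<And>x. x \<in> carrier V \<Longrightarrow> x - (\<Sum>b\<in>F. scaling V (l b x) b) \<in> H"
    by (rule finite_codim_functionals[OF assms]) (rule that)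
  show thesis
  proof (rule that[of "l ` F"])
    show "x \<in> H" if "x \<in> carrier V" "\<forall>l'\<in>l ` F. l' x = 0" for x
      using F(5)[OF that(1)] that(2) by simp
  qed (use F in \<open>auto simp: dual_space_def\<close>)
qed


section \<open>Finite-codimensional ideals\<close>

lemma hom_algebraD:
  assumes "hom_algebra G"
  shows "linear_space G" "bilinear_map G G G (mult G)" "linear_map G G (twist G)"
    "\<And>g h k. g \<in> carrier G \<Longrightarrow> h \<in> carrier G \<Longrightarrow> k \<in> carrier G \<Longrightarrow>
       mult G (twist G g) (mult G h k) = mult G (mult G g h) (twist G k)"
    "\<And>h k. h \<in> carrier G \<Longrightarrow> k \<in> carrier G \<Longrightarrow> twist G (mult G h k) = mult G (twist G h) (twist G k)"
    "\<And>g h. g \<in> carrier G \<Longrightarrow> h \<in> carrier G \<Longrightarrow> mult G g h \<in> carrier G"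
    "\<And>g. g \<in> carrier G \<Longrightarrow> twist G g \<in> carrier G"
  using assms unfolding hom_algebra_def by (auto simp: bilinear_map_def linear_map_def)

lemma hom_idealD:
  assumes "hom_ideal G J"
  shows "J \<subseteq> carrier G" "module.subspace (scaling G) J" "\<And>x. x \<in> J \<Longrightarrow> twist G x \<in> J"
    "\<And>a b. a \<in> carrier G \<Longrightarrow> b \<in> J \<Longrightarrow> mult G a b \<in> J"
    "\<And>a b. a \<in> carrier G \<Longrightarrow> b \<in> J \<Longrightarrow> mult G b a \<in> J"
  using assms unfolding hom_ideal_def by blast+

lemma hom_ideal_Int:
  assumes G: "hom_algebra G" and J: "hom_ideal G J" and J': "hom_ideal G J'"
  shows "hom_ideal G (J \<inter> J')"
  unfolding hom_ideal_def
  using hom_idealD(1)[OF J] module.subspace_inter[OF linear_space_module[OF hom_algebraD(1)[OF G]]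
      hom_idealD(2)[OF J] hom_idealD(2)[OF J']]
  by (auto intro: hom_idealD(3-5)[OF J] hom_idealD(3-5)[OF J'])

lemma finite_codim_Int:
  assumes V: "linear_space V"
    and H: "module.subspace (scaling V) H" "H \<subseteq> carrier V" "finite_codim V H"
    and H': "module.subspace (scaling V) H'" "H' \<subseteq> carrier V" "finite_codim V H'"
  shows "finite_codim V (H \<inter> H')"
proof -
  obtain L where L: "finite L" "\<And>l. l \<in> L \<Longrightarrow> linear_map V scalars l"
    "\<And>x. x \<in> carrier V \<Longrightarrow> \<forall>l\<in>L. l x = 0 \<Longrightarrow> x \<in> H"
    by (rule finite_codim_kernels[OF V H]) (rule that)
  obtain L' where L': "finite L'" "\<And>l. l \<in> L' \<Longrightarrow> linear_map V scalars l"
    "\<And>x. x \<in> carrier V \<Longrightarrow> \<forall>l\<in>L'. l x = 0 \<Longrightarrow> x \<in> H'"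
    by (rule finite_codim_kernels[OF V H']) (rule that)
  show ?thesis
    by (rule finite_codim_if_functionals[OF V
          module.subspace_inter[OF linear_space_module[OF V] H(1) H'(1)], of "L \<union> L'"])
      (use L L' in auto)
qed

lemma subspace_preimage:
  assumes V: "linear_space V" and W: "linear_space W" and f: "linear_map V W f"
    and H: "module.subspace (scaling W) H"
  shows "module.subspace (scaling V) {x \<in> carrier V. f x \<in> H}"
proof -
  interpret V: module "scaling V" using V by (rule linear_space_module)
  interpret W: module "scaling W" using W by (rule linear_space_module)
  show ?thesis
    by (rule V.subspaceI)
      (auto simp: linear_map_0[OF V f] linear_map_add[OF f] linear_map_scale[OF f]
        linear_space_closed[OF V] W.subspace_0[OF H] W.subspace_add[OF H] W.subspace_scale[OF H])
qed

text \<open>Functionals cutting out a subspace of \<open>H\<close> on \<open>W\<close>, composed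
  with \<open>f\<close>, cut out a subspace of the preimage.\<close>

lemma finite_codim_preimage:
  assumes V: "linear_space V" and W: "linear_space W" and f: "linear_map V W f"
    and H: "module.subspace (scaling W) H" "H \<subseteq> carrier W" "finite_codim W H"
  shows "finite_codim V {x \<in> carrier V. f x \<in> H}"
proof -
  obtain L where L: "finite L" "\<And>l. l \<in> L \<Longrightarrow> linear_map W scalars l"
    "\<And>x. x \<in> carrier W \<Longrightarrow> \<forall>l\<in>L. l x = 0 \<Longrightarrow> x \<in> H"
    by (rule finite_codim_kernels[OF W H]) (rule that)
  show ?thesis
  proof (rule finite_codim_if_functionals[OF V subspace_preimage[OF V W f H(1)]])
    show "finite ((\<lambda>l x. l (f x)) ` L)" using L(1) by simp
    show "linear_map V scalars l" if "l \<in> (\<lambda>l x. l (f x)) ` L" for l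
      using that L(2) f by (auto simp: linear_map_def)
    show "x \<in> {x \<in> carrier V. f x \<in> H}"
      if "x \<in> carrier V" "\<forall>l\<in>(\<lambda>l x. l (f x)) ` L. l x = 0" for x
      using that L(3) linear_map_in[OF f] by auto
  qed
qed

lemma hom_ideal_preimage:
  assumes G: "hom_algebra G" and G': "hom_algebra G'" and f: "hom_algebra_morphism G G' f"
    and J: "hom_ideal G' J"
  shows "hom_ideal G {x \<in> carrier G. f x \<in> J}"
proof -
  have lin: "linear_map G G' f"
    and mul: "\<And>x y. x \<in> carrier G \<Longrightarrow> y \<in> carrier G \<Longrightarrow> f (mult G x y) = mult G' (f x) (f y)"
    and tw: "\<And>x. x \<in> carrier G \<Longrightarrow> f (twist G x) = twist G' (f x)"
    using f by (auto simp: hom_algebra_morphism_def)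
  show ?thesis
    unfolding hom_ideal_def
    using subspace_preimage[OF hom_algebraD(1)[OF G] hom_algebraD(1)[OF G'] lin hom_idealD(2)[OF J]]
    by (auto simp: mul tw hom_algebraD(6,7)[OF G] hom_idealD(3-5)[OF J] linear_map_in[OF lin])
qed


section \<open>The Sweedler dual as a linear space\<close>

lemma sweedler_setD:
  assumes "\<phi> \<in> sweedler_set G"
  shows "linear_map G scalars \<phi>" "\<And>x. x \<notin> carrier G \<Longrightarrow> \<phi> x = 0"
  using assms by (auto simp: sweedler_set_def dual_space_def)

lemma sweedler_setE:
  assumes "\<phi> \<in> sweedler_set G"
  obtains J where "hom_ideal G J" "finite_codim G J" "\<And>x. x \<in> J \<Longrightarrow> \<phi> x = 0"
  using assms by (auto simp: sweedler_set_def)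

lemma sweedler_setI:
  assumes "linear_map G scalars \<phi>" "\<And>x. x \<notin> carrier G \<Longrightarrow> \<phi> x = 0"
    and "hom_ideal G J" "finite_codim G J" "\<And>x. x \<in> J \<Longrightarrow> \<phi> x = 0"
  shows "\<phi> \<in> sweedler_set G"
  using assms hom_idealD(1)[OF assms(3)] by (auto simp: sweedler_set_def dual_space_def)

text \<open>The sum vanishes on the intersection of the two ideals, which is again a
  finite-codimensional ideal.\<close>

lemma sweedler_set_add:
  assumes G: "hom_algebra G" and "\<phi> \<in> sweedler_set G" "\<chi> \<in> sweedler_set G"
  shows "\<phi> + \<chi> \<in> sweedler_set G"
proof -
  note \<phi> = sweedler_setD[OF assms(2)] and \<chi> = sweedler_setD[OF assms(3)]
  obtain J where J: "hom_ideal G J" "finite_codim G J" "\<And>x. x \<in> J \<Longrightarrow> \<phi> x = 0"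
    by (rule sweedler_setE[OF assms(2)]) (rule that)
  obtain J' where J': "hom_ideal G J'" "finite_codim G J'" "\<And>x. x \<in> J' \<Longrightarrow> \<chi> x = 0"
    by (rule sweedler_setE[OF assms(3)]) (rule that)
  show ?thesis
  proof (rule sweedler_setI[OF _ _ hom_ideal_Int[OF G J(1) J'(1)]])
    show "linear_map G scalars (\<phi> + \<chi>)"
      using \<phi>(1) \<chi>(1) by (simp add: linear_map_def algebra_simps)
    show "finite_codim G (J \<inter> J')"
      by (rule finite_codim_Int[OF hom_algebraD(1)[OF G] hom_idealD(2,1)[OF J(1)] J(2)
            hom_idealD(2,1)[OF J'(1)] J'(2)])
  qed (use \<phi>(2) \<chi>(2) J(3) J'(3) in auto)
qed

lemma finite_codim_carrier: "linear_space V \<Longrightarrow> finite_codim V (carrier V)"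
  by (rule finite_codim_if_functionals[where L = "{}"]) (auto intro: linear_space_subspace)

lemma hom_ideal_carrier: "hom_algebra G \<Longrightarrow> hom_ideal G (carrier G)"
  by (auto simp: hom_ideal_def hom_algebraD linear_space_subspace)

lemma sweedler_set_0: "hom_algebra G \<Longrightarrow> 0 \<in> sweedler_set G"
  by (rule sweedler_setI[where J = "carrier G"])
    (auto simp: linear_map_def hom_ideal_carrier finite_codim_carrier hom_algebraD)

lemma sweedler_set_scale: "\<phi> \<in> sweedler_set G \<Longrightarrow> fun_scaling a \<phi> \<in> sweedler_set G"
  by (rule sweedler_setE, assumption, rule sweedler_setI)
    (auto simp: linear_map_def fun_scaling_def algebra_simps dest: sweedler_setD)

lemma sweedler_dual_simps [simp]:
  "carrier (sweedler_dual G) = sweedler_set G"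
  "scaling (sweedler_dual G) = fun_scaling"
  "comult (sweedler_dual G) = sweedler_comult G"
  "cotwist (sweedler_dual G) = dual_map G (twist G)"
  by (simp_all add: sweedler_dual_def)

lemma linear_space_sweedler_dual: "hom_algebra G \<Longrightarrow> linear_space (sweedler_dual G)"
  by (auto simp: linear_space_def vector_space_fun_scaling
      intro!: fun_vs.subspaceI sweedler_set_0 sweedler_set_add sweedler_set_scale)

text \<open>If \<open>\<phi>\<close> vanishes on \<open>J\<close>, then its composite with
  \<open>f\<close> vanishes on the preimage of \<open>J\<close>.\<close>

lemma dual_map_in_sweedler:
  assumes G: "hom_algebra G" and G': "hom_algebra G'" and f: "hom_algebra_morphism G G' f"
    and "\<phi> \<in> sweedler_set G'"
  shows "dual_map G f \<phi> \<in> sweedler_set G"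
proof -
  note \<phi> = sweedler_setD[OF assms(4)]
  have lin: "linear_map G G' f" using f by (simp add: hom_algebra_morphism_def)
  obtain J where J: "hom_ideal G' J" "finite_codim G' J" "\<And>x. x \<in> J \<Longrightarrow> \<phi> x = 0"
    by (rule sweedler_setE[OF assms(4)]) (rule that)
  show ?thesis
  proof (rule sweedler_setI[OF _ _ hom_ideal_preimage[OF G G' f J(1)]])
    show "linear_map G scalars (dual_map G f \<phi>)"
      using \<phi>(1) lin linear_space_closed[OF hom_algebraD(1)[OF G]]
      by (auto simp: linear_map_def dual_map_def)
    show "finite_codim G {x \<in> carrier G. f x \<in> J}"
      by (rule finite_codim_preimage[OF hom_algebraD(1)[OF G] hom_algebraD(1)[OF G'] lin
            hom_idealD(2,1)[OF J(1)] J(2)])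
  qed (use J(3) in \<open>auto simp: dual_map_def\<close>)
qed

lemma linear_map_dual_map:
  assumes "hom_algebra G" "hom_algebra G'" "hom_algebra_morphism G G' f"
  shows "linear_map (sweedler_dual G') (sweedler_dual G) (dual_map G f)"
  using dual_map_in_sweedler[OF assms]
  by (auto simp: linear_map_def dual_map_def fun_scaling_def fun_eq_iff)

text \<open>As an endomorphism of \<open>G\<close>, the twist is an instance of \<open>f\<close>;
  the cotwist thus inherits every result about \<open>dual_map G f\<close>.\<close>

lemma hom_algebra_morphism_twist: "hom_algebra G \<Longrightarrow> hom_algebra_morphism G G (twist G)"
  by (simp add: hom_algebra_morphism_def hom_algebraD)


section \<open>The comultiplication\<close>

text \<open>The comultiplication is a field of \<open>sweedler_dual G\<close>, so its definition has
  to form the tensor square from \<open>sweedler_space G\<close>. Tensor products depend only on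
  carrier and scaling, which the two records share.\<close>

lemma tensor_prod_sweedler_space:
  "tensor_prod (sweedler_space G) (sweedler_space G) = tensor_prod (sweedler_dual G) (sweedler_dual G)"
proof -
  have "bilinear_map (sweedler_space G) (sweedler_space G) scalars =
      bilinear_map (sweedler_dual G) (sweedler_dual G) scalars"
    by (auto simp: fun_eq_iff bilinear_map_def linear_map_def sweedler_space_def)
  then show ?thesis
    by (simp add: tensor_prod_def tensor_def sweedler_space_def)
qed

abbreviation sweedler_square :: "('k::field, 'a::ab_group_add) hom_alg \<Rightarrow> _" where
  "sweedler_square G \<equiv> tensor_prod (sweedler_dual G) (sweedler_dual G)"

lemma linear_map_eval: "linear_map (sweedler_dual G) scalars (\<lambda>\<phi>. \<phi> x)"
  by (simp add: linear_map_def fun_scaling_def)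

lemma pairing_linear:
  "pairing 0 x y = 0"
  "pairing (s + t) x y = pairing s x y + pairing t x y"
  "pairing (fun_scaling a t) x y = a * pairing t x y"
  by (simp_all add: pairing_def fun_scaling_def)

lemma linear_map_pairing: "linear_map (tensor_prod V W) scalars (\<lambda>t. pairing t x y)"
  by (simp add: linear_map_def pairing_linear)

lemma pairing_sweedler_tensor: "pairing (tensor (sweedler_dual G) (sweedler_dual G) \<phi> \<chi>) x y = \<phi> x * \<chi> y"
  unfolding pairing_def by (rule tensor_mult[OF linear_map_eval linear_map_eval])

lemma sweedler_eq_0I:
  assumes "\<phi> \<in> sweedler_set G" "\<forall>x\<in>carrier G. \<phi> x = 0"
  shows "\<phi> = 0"
  using assms sweedler_setD(2)[OF assms(1)] by (auto simp: fun_eq_iff)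

text \<open>\<open>tensor_eq_0I\<close> applies with evaluations at points of \<open>G\<close> in
  both factors: a functional in the Sweedler dual is zero outside the carrier, so these evaluations
  separate.\<close>

lemma pairing_eq_0I:
  assumes G: "hom_algebra G" and t: "t \<in> carrier (sweedler_square G)"
    and eq: "\<And>x y. x \<in> carrier G \<Longrightarrow> y \<in> carrier G \<Longrightarrow> pairing t x y = 0"
  shows "t = 0"
proof (rule tensor_eq_0I[OF linear_space_sweedler_dual[OF G] linear_space_sweedler_dual[OF G]])
  let ?D = "(\<lambda>x \<phi>. \<phi> x) ` carrier G"
  show "t (\<lambda>v w. d v * e w) = 0" if "d \<in> ?D" "e \<in> ?D" for d e
    using that eq by (auto simp: pairing_def)
qed (use t in \<open>auto simp: linear_map_eval intro: sweedler_eq_0I\<close>)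

lemma pairing_eqI:
  assumes G: "hom_algebra G" and "s \<in> carrier (sweedler_square G)" "t \<in> carrier (sweedler_square G)"
    and "\<And>x y. x \<in> carrier G \<Longrightarrow> y \<in> carrier G \<Longrightarrow> pairing s x y = pairing t x y"
  shows "s = t"
proof -
  have "s - t = 0"
  proof (rule pairing_eq_0I[OF G])
    show "s - t \<in> carrier (sweedler_square G)"
      using linear_space_diff[OF linear_space_tensor_prod] assms(2,3) .
  qed (use assms(4) in \<open>simp add: pairing_def\<close>)
  then show ?thesis by simp
qed

text \<open>With finitely many \<open>b\<close> spanning \<open>G\<close> modulo \<open>J\<close> and coordinate functionals \<open>l b\<close> vanishing on
  \<open>J\<close>, the tensor is \<open>\<Sum>b. l b \<otimes> \<phi>(b \<cdot> _)\<close>; both factors vanish on \<open>J\<close>.\<close>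

lemma sweedler_comult_exists:
  assumes G: "hom_algebra G" and "\<phi> \<in> sweedler_set G"
  shows "\<exists>t\<in>carrier (sweedler_square G).
    \<forall>x\<in>carrier G. \<forall>y\<in>carrier G. pairing t x y = \<phi> (mult G x y)"
proof -
  note \<phi> = sweedler_setD[OF assms(2)] and lin = hom_algebraD(1)[OF G]
  obtain J where J: "hom_ideal G J" "finite_codim G J" "\<And>x. x \<in> J \<Longrightarrow> \<phi> x = 0"
    by (rule sweedler_setE[OF assms(2)]) (rule that)
  obtain F l where F: "finite F" "F \<subseteq> carrier G" "\<And>b. b \<in> F \<Longrightarrow> l b \<in> dual_space G"
    "\<And>b h. b \<in> F \<Longrightarrow> h \<in> J \<Longrightarrow> l b h = 0"
    "\<And>x. x \<in> carrier G \<Longrightarrow> x - (\<Sum>b\<in>F. scaling G (l b x) b) \<in> J"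
    by (rule finite_codim_functionals[OF lin hom_idealD(2,1)[OF J(1)] J(2)]) (rule that)
  define m where "m b = dual_map G (mult G b) \<phi>" for b
  define t where "t = (\<Sum>b\<in>F. tensor (sweedler_dual G) (sweedler_dual G) (l b) (m b))"
  have l: "l b \<in> sweedler_set G" if "b \<in> F" for b
    using F(3)[OF that] F(4)[OF that] J(1,2) by (auto intro!: sweedler_setI simp: dual_space_def)
  have m: "m b \<in> sweedler_set G" if "b \<in> F" for b
  proof (rule sweedler_setI[OF _ _ J(1,2)])
    have b: "b \<in> carrier G" using that F(2) by blast
    show "linear_map G scalars (m b)"
      using \<phi>(1) bilinear_map_left[OF hom_algebraD(2)[OF G] b] linear_space_closed[OF lin]
      by (auto simp: linear_map_def dual_map_def m_def)
    show "m b x = 0" if "x \<in> J" for x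
      using hom_idealD(4)[OF J(1) b that] J(3) by (simp add: m_def dual_map_def)
  qed (simp add: m_def dual_map_def)
  show ?thesis
  proof (intro bexI ballI)
    have tl: "tensor (sweedler_dual G) (sweedler_dual G) (l b) (m b) \<in> carrier (sweedler_square G)"
      if "b \<in> F" for b
      using l[OF that] m[OF that] by (simp add: tensor_in_tensor_prod)
    then show "t \<in> carrier (sweedler_square G)"
      unfolding t_def by (rule linear_space_sum[OF linear_space_tensor_prod])
    fix x y assume x: "x \<in> carrier G" and y: "y \<in> carrier G"
    let ?M = "\<lambda>x. \<phi> (mult G x y)"
    have M: "linear_map G scalars ?M"
      using \<phi>(1) bilinear_map_right[OF hom_algebraD(2)[OF G] y] by (auto simp: linear_map_def)
    let ?s = "\<Sum>b\<in>F. scaling G (l b x) b"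
    have bF: "scaling G (l b x) b \<in> carrier G" if "b \<in> F" for b
      using that F(2) linear_space_scale[OF lin] by blast
    then have s: "?s \<in> carrier G" by (rule linear_space_sum[OF lin])
    \<comment> \<open>\<open>x - ?s\<close> lies in the ideal \<open>J\<close>, hence so does its
      product with \<open>y\<close>, and \<open>\<phi>\<close> vanishes there.\<close>
    have "?M x - ?M ?s = ?M (x - ?s)" using linear_map_diff[OF lin M x s] by simp
    also have "\<dots> = 0" using hom_idealD(5)[OF J(1) y F(5)[OF x]] J(3) by simp
    finally have "?M x = ?M ?s" by simp
    also have "\<dots> = (\<Sum>b\<in>F. l b x * ?M b)"
      using F(2) bF by (auto simp: linear_map_sum[OF lin M] linear_map_scale[OF M] intro!: sum.cong)
    also have "\<dots> = (\<Sum>b\<in>F. l b x * m b y)"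
      using y by (simp add: m_def dual_map_def)
    also have "\<dots> = (\<Sum>b\<in>F. pairing (tensor (sweedler_dual G) (sweedler_dual G) (l b) (m b)) x y)"
      by (simp add: pairing_sweedler_tensor)
    also have "\<dots> = pairing t x y"
      unfolding t_def using tl
      by (rule linear_map_sum[OF linear_space_tensor_prod linear_map_pairing, symmetric])
    finally show "pairing t x y = \<phi> (mult G x y)" by simp
  qed
qed

text \<open>Existence, together with uniqueness by \<open>pairing_eqI\<close>, makes the definite
  description in \<open>sweedler_comult\<close> meaningful.\<close>

lemma sweedler_comult:
  assumes G: "hom_algebra G" and "\<phi> \<in> sweedler_set G"
  shows sweedler_comult_in: "sweedler_comult G \<phi> \<in> carrier (sweedler_square G)"
    and pairing_sweedler_comult: "\<And>x y. x \<in> carrier G \<Longrightarrow> y \<in> carrier G \<Longrightarrow>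
      pairing (sweedler_comult G \<phi>) x y = \<phi> (mult G x y)"
proof -
  let ?P = "\<lambda>t. t \<in> carrier (sweedler_square G) \<and>
    (\<forall>x\<in>carrier G. \<forall>y\<in>carrier G. pairing t x y = \<phi> (mult G x y))"
  have "\<exists>!t. ?P t"
    using sweedler_comult_exists[OF assms] pairing_eqI[OF G] by (metis (no_types, lifting))
  then have *: "?P (sweedler_comult G \<phi>)"
    unfolding sweedler_comult_def tensor_prod_sweedler_space by (rule theI')
  show "sweedler_comult G \<phi> \<in> carrier (sweedler_square G)"
    and "\<And>x y. x \<in> carrier G \<Longrightarrow> y \<in> carrier G \<Longrightarrow>
      pairing (sweedler_comult G \<phi>) x y = \<phi> (mult G x y)"
    using * by blast+
qed

lemma linear_map_sweedler_comult:
  assumes G: "hom_algebra G"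
  shows "linear_map (sweedler_dual G) (sweedler_square G) (sweedler_comult G)"
  unfolding linear_map_def
proof (intro conjI ballI allI)
  fix \<phi> assume \<phi>: "\<phi> \<in> carrier (sweedler_dual G)"
  then show "sweedler_comult G \<phi> \<in> carrier (sweedler_square G)"
    by (simp add: sweedler_comult_in[OF G])
  show "sweedler_comult G (scaling (sweedler_dual G) a \<phi>) =
      scaling (sweedler_square G) a (sweedler_comult G \<phi>)" for a
    using \<phi> by (intro pairing_eqI[OF G])
      (simp_all add: sweedler_comult[OF G] sweedler_set_scale tensor_prod_closed pairing_linear,
        simp add: fun_scaling_def)
  fix \<chi> assume "\<chi> \<in> carrier (sweedler_dual G)"
  then show "sweedler_comult G (\<phi> + \<chi>) = sweedler_comult G \<phi> + sweedler_comult G \<chi>"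
    using \<phi> by (intro pairing_eqI[OF G])
      (simp_all add: sweedler_comult[OF G] sweedler_set_add[OF G] tensor_prod_closed pairing_linear)
qed

section \<open>Naturality of the comultiplication\<close>

lemma pairing_tensor_map_dual_map:
  assumes G: "hom_algebra G" and G': "hom_algebra G'" and f: "hom_algebra_morphism G G' f"
    and t: "t \<in> carrier (sweedler_square G')" and "x \<in> carrier G" "y \<in> carrier G"
  shows "pairing (tensor_map (sweedler_dual G) (sweedler_dual G) (dual_map G f) (dual_map G f) t) x y
    = pairing t (f x) (f y)"
  using t
proof (induction rule: tensor_prod_induct)
  case (tensor \<phi> \<chi>)
  note L = linear_map_dual_map[OF G G' f]
  show ?case
    unfolding tensor_map_tensor[OF L L tensor] pairing_sweedler_tensor
    using assms(5,6) by (simp add: dual_map_def)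
qed (simp_all add: tensor_map_linear pairing_linear
        del: zero_fun_apply plus_fun_apply)

text \<open>Evaluated at \<open>x\<close> and \<open>y\<close>, both sides give
  \<open>\<phi>\<close> of \<open>f\<close> of the product, because \<open>f\<close> is
  multiplicative. It is used twice: for \<open>f\<close>, and for \<open>twist G\<close> as
  compatibility of comultiplication and cotwist.\<close>

lemma sweedler_comult_dual_map:
  assumes G: "hom_algebra G" and G': "hom_algebra G'" and f: "hom_algebra_morphism G G' f"
    and \<phi>: "\<phi> \<in> sweedler_set G'"
  shows "sweedler_comult G (dual_map G f \<phi>) =
    tensor_map (sweedler_dual G) (sweedler_dual G) (dual_map G f) (dual_map G f) (sweedler_comult G' \<phi>)"
proof (rule pairing_eqI[OF G])
  note L = linear_map_dual_map[OF G G' f] and in' = dual_map_in_sweedler[OF G G' f \<phi>]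
  have lin: "linear_map G G' f" using f by (simp add: hom_algebra_morphism_def)
  show "sweedler_comult G (dual_map G f \<phi>) \<in> carrier (sweedler_square G)"
    by (rule sweedler_comult_in[OF G in'])
  show "tensor_map (sweedler_dual G) (sweedler_dual G) (dual_map G f) (dual_map G f)
      (sweedler_comult G' \<phi>) \<in> carrier (sweedler_square G)"
    by (rule tensor_map_in[OF L L sweedler_comult_in[OF G' \<phi>]])
  fix x y assume xy: "x \<in> carrier G" "y \<in> carrier G"
  then have "f (mult G x y) = mult G' (f x) (f y)" using f by (simp add: hom_algebra_morphism_def)
  then show "pairing (sweedler_comult G (dual_map G f \<phi>)) x y =
      pairing (tensor_map (sweedler_dual G) (sweedler_dual G) (dual_map G f) (dual_map G f)
        (sweedler_comult G' \<phi>)) x y"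
    using xy by (simp add: pairing_sweedler_comult[OF G in'] pairing_sweedler_comult[OF G' \<phi>]
        pairing_tensor_map_dual_map[OF G G' f sweedler_comult_in[OF G' \<phi>]] linear_map_in[OF lin]
        hom_algebraD(6)[OF G])
      (simp add: dual_map_def hom_algebraD(6)[OF G])
qed


section \<open>Coassociativity\<close>

text \<open>The analogue of \<open>pairing\<close> for three factors, bracketed to the right because
  both sides of coassociativity lie in that tensor product.\<close>

definition triple_pairing ::
  "('k::field, 'a \<Rightarrow> 'k, ('k, 'a \<Rightarrow> 'k, 'a \<Rightarrow> 'k) tensor) tensor \<Rightarrow> 'a \<Rightarrow> 'a \<Rightarrow> 'a \<Rightarrow> 'k" where
  "triple_pairing t x y z = t (\<lambda>\<phi> s. \<phi> x * pairing s y z)"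

lemma triple_pairing_linear:
  "triple_pairing 0 x y z = 0"
  "triple_pairing (s + t) x y z = triple_pairing s x y z + triple_pairing t x y z"
  "triple_pairing (fun_scaling a t) x y z = a * triple_pairing t x y z"
  by (simp_all add: triple_pairing_def fun_scaling_def)

lemma triple_pairing_tensor:
  "triple_pairing (tensor (sweedler_dual G) (sweedler_square G) \<phi> s) x y z = \<phi> x * pairing s y z"
  unfolding triple_pairing_def by (rule tensor_mult[OF linear_map_eval linear_map_pairing])

text \<open>\<open>tensor_eq_0I\<close> is applied with point evaluations on the left factor and
  pairings on the right one; the latter separate by \<open>pairing_eq_0I\<close>.\<close>

lemma triple_pairing_eqI:
  assumes G: "hom_algebra G"
    and s: "s \<in> carrier (tensor_prod (sweedler_dual G) (sweedler_square G))"
    and t: "t \<in> carrier (tensor_prod (sweedler_dual G) (sweedler_square G))"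
    and eq: "\<And>x y z. x \<in> carrier G \<Longrightarrow> y \<in> carrier G \<Longrightarrow> z \<in> carrier G \<Longrightarrow>
      triple_pairing s x y z = triple_pairing t x y z"
  shows "s = t"
proof -
  have "s - t = 0"
  proof (rule tensor_eq_0I[OF linear_space_sweedler_dual[OF G] linear_space_tensor_prod])
    let ?D = "(\<lambda>x \<phi>. \<phi> x) ` carrier G"
    let ?E = "(\<lambda>(y, z) s. pairing s y z) ` (carrier G \<times> carrier G)"
    show "s - t \<in> carrier (tensor_prod (sweedler_dual G) (sweedler_square G))"
      using linear_space_diff[OF linear_space_tensor_prod s t] .
    show "(s - t) (\<lambda>v w. d v * e w) = 0" if "d \<in> ?D" "e \<in> ?E" for d e
      using that eq by (auto simp: triple_pairing_def)
    show "w = 0" if "w \<in> carrier (sweedler_square G)" "\<forall>e\<in>?E. e w = 0" for w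
      using pairing_eq_0I[OF G that(1)] that(2) by force
  qed (auto simp: linear_map_eval linear_map_pairing intro: sweedler_eq_0I)
  then show ?thesis by simp
qed

text \<open>Reassociation preserves evaluation at three points. The left factor \<open>s\<close> is
  a general tensor because it will be the value of a comultiplication.\<close>

lemma triple_pairing_tensor_assoc:
  assumes G: "hom_algebra G" and s: "s \<in> carrier (sweedler_square G)" and \<chi>: "\<chi> \<in> sweedler_set G"
  shows "triple_pairing (tensor_assoc (sweedler_dual G) (sweedler_dual G) (sweedler_dual G)
      (tensor (sweedler_square G) (sweedler_dual G) s \<chi>)) x y z = pairing s x y * \<chi> z"
proof -
  let ?C = "sweedler_dual G"
  have \<chi>': "\<chi> \<in> carrier ?C" using \<chi> by simp
  note L = tensor_left[OF \<chi>', of "sweedler_square G"]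
  have "s \<in> carrier (sweedler_square G) \<and>
    triple_pairing (tensor_assoc ?C ?C ?C (tensor (sweedler_square G) ?C s \<chi>)) x y z
      = pairing s x y * \<chi> z"
    using s
  proof (induction rule: tensor_prod_induct)
    case (tensor u v)
    then show ?case
      using \<chi> by (simp add: tensor_assoc_tensor[OF linear_space_sweedler_dual[OF G]]
          triple_pairing_tensor pairing_sweedler_tensor tensor_in_tensor_prod)
  next
    case zero
    show ?case
      by (simp add: linear_map_0[OF linear_space_tensor_prod L] tensor_assoc_linear
          triple_pairing_linear pairing_linear tensor_prod_closed
        del: zero_fun_apply plus_fun_apply)
  next
    case (add s t)
    then show ?case
      by (simp add: linear_map_add[OF L] tensor_assoc_linear triple_pairing_linear
          pairing_linear tensor_prod_closed algebra_simps del: zero_fun_apply plus_fun_apply)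
  next
    case (scaling a s)
    then show ?case
      using linear_map_scale[OF L, of s a]
      by (simp add: tensor_assoc_linear triple_pairing_linear pairing_linear tensor_prod_closed
        del: zero_fun_apply plus_fun_apply)
  qed
  then show ?thesis by simp
qed

text \<open>At \<open>x\<close>, \<open>y\<close>, \<open>z\<close> the two sides evaluate to
  \<open>\<phi>\<close> of the two sides of Hom-associativity.\<close>

lemma sweedler_coassociative:
  assumes G: "hom_algebra G" and \<phi>: "\<phi> \<in> sweedler_set G"
  defines "C \<equiv> sweedler_dual G"
  shows "tensor_map C (tensor_prod C C) (cotwist C) (comult C) (comult C \<phi>) =
    tensor_assoc C C C (tensor_map (tensor_prod C C) C (comult C) (cotwist C) (comult C \<phi>))"
proof (rule triple_pairing_eqI[OF G])
  have LA: "linear_map C C (cotwist C)"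
    using linear_map_dual_map[OF G G hom_algebra_morphism_twist[OF G]] by (simp add: C_def)
  have LD: "linear_map C (tensor_prod C C) (comult C)"
    using linear_map_sweedler_comult[OF G] by (simp add: C_def)
  have t: "comult C \<phi> \<in> carrier (tensor_prod C C)"
    using sweedler_comult_in[OF G \<phi>] by (simp add: C_def)
  show "tensor_map C (tensor_prod C C) (cotwist C) (comult C) (comult C \<phi>)
      \<in> carrier (tensor_prod (sweedler_dual G) (sweedler_square G))"
    using tensor_map_in[OF LA LD t] by (simp add: C_def)
  show "tensor_assoc C C C (tensor_map (tensor_prod C C) C (comult C) (cotwist C) (comult C \<phi>))
      \<in> carrier (tensor_prod (sweedler_dual G) (sweedler_square G))"
    using tensor_assoc_in[OF _ tensor_map_in[OF LD LA t]] linear_space_sweedler_dual[OF G]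
    by (simp add: C_def)
  fix x y z assume xyz: "x \<in> carrier G" "y \<in> carrier G" "z \<in> carrier G"
  \<comment> \<open>Proved for every \<open>t\<close> in the tensor square so that induction on
    tensors applies; \<open>comult C \<phi>\<close> is inserted at the end.\<close>
  have "triple_pairing (tensor_map C (tensor_prod C C) (cotwist C) (comult C) t) x y z =
      pairing t (twist G x) (mult G y z)" if "t \<in> carrier (tensor_prod C C)" for t
    using that
  proof (induction rule: tensor_prod_induct)
    case (tensor \<phi> \<chi>)
    show ?case
      unfolding tensor_map_tensor[OF LA LD tensor]
      using tensor xyz unfolding C_def
      by (simp add: triple_pairing_tensor pairing_sweedler_tensor pairing_sweedler_comult[OF G]
          dual_map_def)
  qed (simp_all add: tensor_map_linear triple_pairing_linear pairing_linear
        del: zero_fun_apply plus_fun_apply)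
  moreover have "triple_pairing (tensor_assoc C C C
        (tensor_map (tensor_prod C C) C (comult C) (cotwist C) t)) x y z =
      pairing t (mult G x y) (twist G z)" if "t \<in> carrier (tensor_prod C C)" for t
    using that
  proof (induction rule: tensor_prod_induct)
    case (tensor \<phi> \<chi>)
    have "dual_map G (twist G) \<chi> \<in> sweedler_set G"
      using linear_map_in[OF LA] tensor(2) by (simp add: C_def)
    then show ?case
      unfolding tensor_map_tensor[OF LD LA tensor]
      using tensor xyz unfolding C_def
      by (simp add: triple_pairing_tensor_assoc[OF G] pairing_sweedler_tensor sweedler_comult[OF G]
          dual_map_def)
  qed (simp_all add: tensor_map_linear tensor_assoc_linear triple_pairing_linear pairing_linear
        del: zero_fun_apply plus_fun_apply)
  ultimately show "triple_pairing (tensor_map C (tensor_prod C C) (cotwist C) (comult C) (comult C \<phi>)) x y z =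
      triple_pairing (tensor_assoc C C C
        (tensor_map (tensor_prod C C) C (comult C) (cotwist C) (comult C \<phi>))) x y z"
    using t xyz by (simp add: C_def pairing_sweedler_comult[OF G \<phi>] hom_algebraD(4,6,7)[OF G])
qed

theorem hom_coalgebra_sweedler_dual:
  assumes G: "hom_algebra G"
  shows "hom_coalgebra (sweedler_dual G)"
  unfolding hom_coalgebra_def
  using linear_space_sweedler_dual[OF G] linear_map_sweedler_comult[OF G]
    linear_map_dual_map[OF G G hom_algebra_morphism_twist[OF G]]
    sweedler_coassociative[OF G]
    sweedler_comult_dual_map[OF G G hom_algebra_morphism_twist[OF G]]
  by simp

text \<open>\<open>dual_map G f\<close> is the transpose of \<open>f\<close>, extended by zero. That
  it maps into the Sweedler dual of \<open>G\<close> is part of the \<open>linear_map\<close>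
  condition in the conclusion.\<close>

theorem corollary2p11:
  fixes G :: "('k::field_char_0, 'a::ab_group_add) hom_alg"
    and G' :: "('k, 'b::ab_group_add) hom_alg"
    and f :: "'a \<Rightarrow> 'b"
  assumes "hom_algebra G" and "hom_algebra G'"
    and "hom_algebra_morphism G G' f"
  shows "hom_coalgebra_morphism (sweedler_dual G') (sweedler_dual G) (dual_map G f)"
proof -
  \<comment> \<open>The transpose of the relation between \<open>f\<close> and the twists; off the
    carrier of \<open>G\<close> both sides are 0.\<close>
  have "dual_map G f (dual_map G' (twist G') \<phi>) = dual_map G (twist G) (dual_map G f \<phi>)" for \<phi>
    using assms hom_algebraD(7)[OF assms(1)]
    by (auto simp: dual_map_def fun_eq_iff hom_algebra_morphism_def linear_map_def)
  then show ?thesis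
    unfolding hom_coalgebra_morphism_def
    using hom_coalgebra_sweedler_dual[OF assms(1)] hom_coalgebra_sweedler_dual[OF assms(2)]
      linear_map_dual_map[OF assms] sweedler_comult_dual_map[OF assms]
    by simp
qed

end
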